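(* Let $(X,d)$ be a strongly hyperbolic space and $\Gamma<\operatorname{Isom}(X)$ a subgroup acting $3$-transitively on $\partial X$. If an abstract cross-ratio $B$ on $\partial X$ generating the topology is $\Gamma$-invariant, then there exists $t>0$ such that for all $(w,x,y,z)\in(\partial X)^{(4)}$ we have $B(w,x,y,z)=[w,x;y,z]^t$. Consequently, let $X_1,X_2$ be strongly hyperbolic spaces and let $f\colon\partial X_1\to\partial X_2$ be a map which is a homeomorphism onto its image and is equivariant under the action of a subgroup $\Gamma\subset\operatorname{Isom}(X_1)$ acting $3$-transitively on $\partial X_1$ (and acting by isometries on $X_2$). Then there is $t>0$ such that for all $(w,x,y,z)\in(\partial X_1)^{(4)}$ we have $$[f(w),f(x);f(y),f(z)]_{\partial X_2}=[w,x;y,z]_{\partial X_1}^t .$$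
   Context: Metric spaces are not assumed proper or complete. For a metric space $(X,d)$ and $o\in X$, the Gromov product is $(x\mid y)_o=\frac12(d(o,x)+d(o,y)-d(x,y))$ and $d_o(x,y)=\exp(-(x\mid y)_o)$. For $\varepsilon>0$, $(X,d)$ is strongly-$\varepsilon$-hyperbolic when $d_o^\varepsilon(x,z)\le d_o^\varepsilon(x,y)+d_o^\varepsilon(y,z)$ for all $o,x,y,z\in X$; it is strongly hyperbolic when this holds for some $\varepsilon>0$. It is then Gromov hyperbolic; $\partial X$ denotes its Gromov boundary (classes of sequences converging to infinity). The Gromov product and $d_o$ extend continuously to $X\sqcup\partial X$, $d_o^\varepsilon$ restricts to a metric on $\partial X$ which induces its topology. For a topological space $Y$, $Y^{(4)}\subset Y^4$ is the set of quadruples of which at least three entries are distinct. The cross-ratio on $(\partial X)^{(4)}$ is the $[0,\infty]$-valued function $[a,a';b,b']=\frac{d_o(a,a')\,d_o(b,b')}{d_o(a,b')\,d_o(b,a')}$, independent of $o$; it extends $\exp\frac12(d(x,x')+d(y,y')-d(x,y')-d(y,x'))$ from $X$. An abstract cross-ratio on $Y$ is a continuous function $B\colon Y^{(4)}\to[0,\infty]$ such that (whenever the expressions are defined): $B(x,x',y,y')=B(y,y',x,x')=B(x',x,y',y)$; $B(x,x',y,y')=B(y,x',x,y')^{-1}=B(x,y',y,x')^{-1}$; $B(x,y,x',y')=B(x,y,x'',y')\,B(x'',y,x',y')$; $B(x,x',y,y')=0$ iff $x=x'$ or $y=y'$; $B(x,x',y,y')=\infty$ iff $x=y'$ or $y=x'$.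 It generates the topology when for every triple of distinct points $x,y,z\in Y$, the sets $\{w\in Y: B(w,x,y,z)<\varepsilon\}$, $\varepsilon>0$, form a basis of neighbourhoods of $x$. A group acts $3$-transitively when any triple of distinct points can be mapped to any other triple of distinct points. *)

theory Defs
  imports "HOL-Analysis.Analysis" "HOL-Algebra.Group"
begin

definition gromov_product :: "'a::metric_space \<Rightarrow> 'a \<Rightarrow> 'a \<Rightarrow> real" where
  "gromov_product p x y = (dist p x + dist p y - dist x y) / 2"

definition gromov_dist :: "'a::metric_space \<Rightarrow> 'a \<Rightarrow> 'a \<Rightarrow> real" where
  "gromov_dist p x y = exp (- gromov_product p x y)"

definition strongly_eps_hyperbolic :: "'a::metric_space itself \<Rightarrow> real \<Rightarrow> bool" where
  "strongly_eps_hyperbolic _ \<epsilon> \<longleftrightarrow>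
     (\<forall>p x y z :: 'a. gromov_dist p x z powr \<epsilon>
        \<le> gromov_dist p x y powr \<epsilon> + gromov_dist p y z powr \<epsilon>)"

definition strongly_hyperbolic :: "'a::metric_space itself \<Rightarrow> bool" where
  "strongly_hyperbolic X \<longleftrightarrow> (\<exists>\<epsilon>>0. strongly_eps_hyperbolic X \<epsilon>)"

definition converges_to_infinity :: "(nat \<Rightarrow> 'a::metric_space) \<Rightarrow> bool" where
  "converges_to_infinity s \<longleftrightarrow>
     (\<forall>p. filterlim (\<lambda>(i, j). gromov_product p (s i) (s j)) at_top
        (sequentially \<times>\<^sub>F sequentially))"

definition boundary_rel :: "((nat \<Rightarrow> 'a::metric_space) \<times> (nat \<Rightarrow> 'a)) set" where
  "boundary_rel = {(s, t). converges_to_infinity s \<and> converges_to_infinity t \<and>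
     (\<forall>p. filterlim (\<lambda>(i, j). gromov_product p (s i) (t j)) at_top
        (sequentially \<times>\<^sub>F sequentially))}"

definition gromov_boundary :: "(nat \<Rightarrow> 'a::metric_space) set set" where
  "gromov_boundary = {s. converges_to_infinity s} // boundary_rel"

(* The continuous extension of gromov_dist to boundary points.  In a strongly hyperbolic
   space the double limit exists and does not depend on the representing sequences; it is 0
   exactly when the two boundary points coincide. *)
definition boundary_dist ::
    "'a::metric_space \<Rightarrow> (nat \<Rightarrow> 'a) set \<Rightarrow> (nat \<Rightarrow> 'a) set \<Rightarrow> real" where
  "boundary_dist p \<xi> \<eta> =
     (THE l. \<forall>s\<in>\<xi>. \<forall>t\<in>\<eta>. ((\<lambda>(i, j). gromov_dist p (s i) (t j)) \<longlongrightarrow> l)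
        (sequentially \<times>\<^sub>F sequentially))"

(* In a strongly epsilon-hyperbolic space this is the metric topology of
   boundary_dist p powr epsilon, for any base point p. *)
definition boundary_topology :: "(nat \<Rightarrow> 'a::metric_space) set topology" where
  "boundary_topology = topology (\<lambda>U. U \<subseteq> gromov_boundary \<and>
     (\<forall>p. \<forall>\<xi>\<in>U. \<exists>r>0. \<forall>\<eta>\<in>gromov_boundary. boundary_dist p \<xi> \<eta> < r \<longrightarrow> \<eta> \<in> U))"

lemma openin_boundary_topology:
  "openin boundary_topology U \<longleftrightarrow> U \<subseteq> gromov_boundary \<and>
     (\<forall>p. \<forall>\<xi>\<in>U. \<exists>r>0. \<forall>\<eta>\<in>gromov_boundary. boundary_dist p \<xi> \<eta> < r \<longrightarrow> \<eta> \<in> U)"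
proof -
  have "istopology (\<lambda>U. U \<subseteq> gromov_boundary \<and>
     (\<forall>p::'a. \<forall>\<xi>\<in>U. \<exists>r>0. \<forall>\<eta>\<in>gromov_boundary. boundary_dist p \<xi> \<eta> < r \<longrightarrow> \<eta> \<in> U))"
    (is "istopology ?P")
    unfolding istopology_def
  proof (intro conjI allI impI)
    fix S T assume S: "?P S" and T: "?P T"
    show "S \<inter> T \<subseteq> gromov_boundary" using S by blast
    show "\<forall>\<xi>\<in>S \<inter> T. \<exists>r>0. \<forall>\<eta>\<in>gromov_boundary. boundary_dist p \<xi> \<eta> < r \<longrightarrow> \<eta> \<in> S \<inter> T"
      for p :: 'a
    proof
      fix \<xi> assume "\<xi> \<in> S \<inter> T"
      with S T obtain r r' where
        "r > 0" "\<forall>\<eta>\<in>gromov_boundary. boundary_dist p \<xi> \<eta> < r \<longrightarrow> \<eta> \<in> S"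
        "r' > 0" "\<forall>\<eta>\<in>gromov_boundary. boundary_dist p \<xi> \<eta> < r' \<longrightarrow> \<eta> \<in> T"
        by blast
      then show "\<exists>r>0. \<forall>\<eta>\<in>gromov_boundary. boundary_dist p \<xi> \<eta> < r \<longrightarrow> \<eta> \<in> S \<inter> T"
        by (intro exI[of _ "min r r'"]) auto
    qed
  next
    fix \<K> assume "\<forall>K\<in>\<K>. ?P K"
    then show "\<Union>\<K> \<subseteq> gromov_boundary" by blast
    show "\<forall>\<xi>\<in>\<Union>\<K>. \<exists>r>0. \<forall>\<eta>\<in>gromov_boundary. boundary_dist p \<xi> \<eta> < r \<longrightarrow> \<eta> \<in> \<Union>\<K>"
      for p :: 'a
      using \<open>\<forall>K\<in>\<K>. ?P K\<close> by (meson UnionE UnionI)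
  qed
  then show ?thesis
    unfolding boundary_topology_def by (simp add: topology_inverse')
qed

lemma topspace_boundary_topology [simp]: "topspace boundary_topology = gromov_boundary"
proof
  show "topspace boundary_topology \<subseteq> gromov_boundary"
    by (meson openin_boundary_topology openin_topspace)
  have "openin boundary_topology gromov_boundary"
    unfolding openin_boundary_topology by (auto intro: zero_less_one)
  then show "gromov_boundary \<subseteq> topspace boundary_topology"
    by (rule openin_subset)
qed

definition quadruples :: "'b set \<Rightarrow> ('b \<times> 'b \<times> 'b \<times> 'b) set" where
  "quadruples Y = {(a, b, c, d). {a, b, c, d} \<subseteq> Y \<and> card {a, b, c, d} \<ge> 3}"

(* On quadruples of boundary points the numerator and the denominator never vanish
   simultaneously, and x / 0 = \<infinity> in ennreal for x \<noteq> 0.  In a strongly hyperbolic space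
   the value does not depend on the base point p. *)
definition cross_ratio ::
    "'a::metric_space \<Rightarrow> (nat \<Rightarrow> 'a) set \<times> (nat \<Rightarrow> 'a) set \<times> (nat \<Rightarrow> 'a) set \<times> (nat \<Rightarrow> 'a) set \<Rightarrow> ennreal"
  where
  "cross_ratio p = (\<lambda>(a, a', b, b').
     ennreal (boundary_dist p a a' * boundary_dist p b b') /
     ennreal (boundary_dist p a b' * boundary_dist p b a'))"

(* The power of a [0, \<infinity>]-valued base, meant for positive exponents. *)
definition ennreal_powr :: "ennreal \<Rightarrow> real \<Rightarrow> ennreal" where
  "ennreal_powr c t = (if c = \<infinity> then \<infinity> else ennreal (enn2real c powr t))"

(* In the cocycle identity the product must be defined, i.e. not of the form 0 * \<infinity>
   (which is 0 in ennreal). *)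
definition abstract_cross_ratio :: "'b topology \<Rightarrow> ('b \<times> 'b \<times> 'b \<times> 'b \<Rightarrow> ennreal) \<Rightarrow> bool" where
  "abstract_cross_ratio T B \<longleftrightarrow>
     continuous_map
       (subtopology (prod_topology T (prod_topology T (prod_topology T T)))
          (quadruples (topspace T))) euclidean B \<and>
     (\<forall>x x' y y'. (x, x', y, y') \<in> quadruples (topspace T) \<longrightarrow>
        B (x, x', y, y') = B (y, y', x, x') \<and>
        B (x, x', y, y') = B (x', x, y', y) \<and>
        B (x, x', y, y') = inverse (B (y, x', x, y')) \<and>
        B (x, x', y, y') = inverse (B (x, y', y, x')) \<and>
        (B (x, x', y, y') = 0 \<longleftrightarrow> x = x' \<or> y = y') \<and>
        (B (x, x', y, y') = \<infinity> \<longleftrightarrow> x = y' \<or> y = x')) \<and>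
     (\<forall>x y x' y' x''.
        (x, y, x', y') \<in> quadruples (topspace T) \<and>
        (x, y, x'', y') \<in> quadruples (topspace T) \<and>
        (x'', y, x', y') \<in> quadruples (topspace T) \<and>
        \<not> (B (x, y, x'', y') = 0 \<and> B (x'', y, x', y') = \<infinity>) \<and>
        \<not> (B (x, y, x'', y') = \<infinity> \<and> B (x'', y, x', y') = 0) \<longrightarrow>
        B (x, y, x', y') = B (x, y, x'', y') * B (x'', y, x', y'))"

definition generates_topology :: "'b topology \<Rightarrow> ('b \<times> 'b \<times> 'b \<times> 'b \<Rightarrow> ennreal) \<Rightarrow> bool" where
  "generates_topology T B \<longleftrightarrow>
     (\<forall>x\<in>topspace T. \<forall>y\<in>topspace T. \<forall>z\<in>topspace T. x \<noteq> y \<and> x \<noteq> z \<and> y \<noteq> z \<longrightarrow>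
        (\<forall>\<epsilon>::real. \<epsilon> > 0 \<longrightarrow>
           (\<exists>U. openin T U \<and> x \<in> U \<and> U \<subseteq> {w \<in> topspace T. B (w, x, y, z) < ennreal \<epsilon>})) \<and>
        (\<forall>U. openin T U \<and> x \<in> U \<longrightarrow>
           (\<exists>\<epsilon>::real. \<epsilon> > 0 \<and> {w \<in> topspace T. B (w, x, y, z) < ennreal \<epsilon>} \<subseteq> U)))"

definition isometry_group :: "('a::metric_space \<Rightarrow> 'a) monoid" where
  "isometry_group =
     \<lparr>carrier = {g. bij g \<and> (\<forall>x y. dist (g x) (g y) = dist x y)}, mult = (\<circ>), one = id\<rparr>"

definition boundary_act :: "('a \<Rightarrow> 'a) \<Rightarrow> (nat \<Rightarrow> 'a) set \<Rightarrow> (nat \<Rightarrow> 'a) set" where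
  "boundary_act g \<xi> = (\<lambda>s. g \<circ> s) ` \<xi>"

definition three_transitive_on_boundary :: "('a::metric_space \<Rightarrow> 'a) set \<Rightarrow> bool" where
  "three_transitive_on_boundary \<Gamma> \<longleftrightarrow>
     (\<forall>x\<in>gromov_boundary. \<forall>y\<in>gromov_boundary. \<forall>z\<in>gromov_boundary.
      \<forall>x'\<in>gromov_boundary. \<forall>y'\<in>gromov_boundary. \<forall>z'\<in>gromov_boundary.
        x \<noteq> y \<and> x \<noteq> z \<and> y \<noteq> z \<and> x' \<noteq> y' \<and> x' \<noteq> z' \<and> y' \<noteq> z' \<longrightarrow>
        (\<exists>g\<in>\<Gamma>. boundary_act g x = x' \<and> boundary_act g y = y' \<and> boundary_act g z = z'))"

definition boundary_invariant ::
    "('a::metric_space \<Rightarrow> 'a) set \<Rightarrow>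
     ((nat \<Rightarrow> 'a) set \<times> (nat \<Rightarrow> 'a) set \<times> (nat \<Rightarrow> 'a) set \<times> (nat \<Rightarrow> 'a) set \<Rightarrow> ennreal) \<Rightarrow> bool" where
  "boundary_invariant \<Gamma> B \<longleftrightarrow>
     (\<forall>g\<in>\<Gamma>. \<forall>(w, x, y, z)\<in>quadruples gromov_boundary.
        B (boundary_act g w, boundary_act g x, boundary_act g y, boundary_act g z) = B (w, x, y, z))"

end

(*
  Fix distinct boundary points o', e, i and put N_B(w) = B(w,o',e,i), and likewise N_C for the
  standard cross-ratio C.  By the cocycle identity an element g of Gamma fixing o' and i satisfies
  N_B(g w) = N_B(w) N_B(g e).  As these elements act transitively on the complement of {o', i}, the
  points (ln N_B(w), ln N_C(w)) form a subgroup of the plane.  Both cross-ratios generate the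
  topology, so N_B(w_n) -> 0 iff w_n -> o' iff N_C(w_n) -> 0; along multiples of an element of the
  subgroup this shows that its two coordinates have the same sign.  Such a subgroup lies on a line
  through the origin with positive slope t, i.e. N_B = N_C^t, and 3-transitivity spreads this to all
  quadruples.  The second claim is the same statement for the pullback of the cross-ratio of the
  second boundary.
*)
theory Submission imports Defs
begin

section \<open>Invariant cross-ratios\<close>

text \<open>\<open>multiplicative_cross_ratio\<close> keeps the rules shared by an abstract
  cross-ratio, the boundary cross-ratio and its pullback under an embedding, so that one comparison
  serves both claims. Its cocycle rule keeps \<open>x\<close>, \<open>x'\<close>, \<open>x''\<close>
  off \<open>y\<close> and \<open>y'\<close>: all three values are then finite and nonzero,
  logarithms make sense and no product of 0 and infinity arises in \<open>ennreal\<close>. The value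
  1 on \<open>(x, z, y, z)\<close> is listed because the last three entries of such a quadruple are
  not distinct, so that 3-transitivity cannot bring them to \<open>(o', e, i)\<close>.

  Nothing is known beforehand about the shape of the subgroup of the plane, which may be discrete or
  dense; slopes are therefore compared through rational numbers. The metric side has its own
  obstacles. The space need not be proper or complete, so boundary distances are built from the
  completeness of the reals. An isometry moves the base point, so invariance of the boundary
  cross-ratio rests on its independence of the base point.\<close>

definition multiplicative_cross_ratio :: "'b set \<Rightarrow> ('b \<times> 'b \<times> 'b \<times> 'b \<Rightarrow> ennreal) \<Rightarrow> bool" where
  "multiplicative_cross_ratio Y B \<longleftrightarrow>
     (\<forall>x x' y y'. (x, x', y, y') \<in> quadruples Y \<longrightarrow>
        (B (x, x', y, y') = 0 \<longleftrightarrow> x = x' \<or> y = y') \<and>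
        (B (x, x', y, y') = \<infinity> \<longleftrightarrow> x = y' \<or> y = x')) \<and>
     (\<forall>x\<in>Y. \<forall>y\<in>Y. \<forall>z\<in>Y. x \<noteq> y \<and> x \<noteq> z \<and> y \<noteq> z \<longrightarrow> B (x, z, y, z) = 1) \<and>
     (\<forall>x\<in>Y. \<forall>x'\<in>Y. \<forall>x''\<in>Y. \<forall>y\<in>Y. \<forall>y'\<in>Y.
        y \<noteq> y' \<and> x \<notin> {y, y'} \<and> x' \<notin> {y, y'} \<and> x'' \<notin> {y, y'} \<longrightarrow>
        B (x, y, x', y') = B (x, y, x'', y') * B (x'', y, x', y'))"

lemma
  assumes "multiplicative_cross_ratio Y B"
  shows multiplicative_cross_ratio_eq_0:
      "(x, x', y, y') \<in> quadruples Y \<Longrightarrow> B (x, x', y, y') = 0 \<longleftrightarrow> x = x' \<or> y = y'"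
    and multiplicative_cross_ratio_eq_top:
      "(x, x', y, y') \<in> quadruples Y \<Longrightarrow> B (x, x', y, y') = \<infinity> \<longleftrightarrow> x = y' \<or> y = x'"
    and multiplicative_cross_ratio_eq_1:
      "\<lbrakk>x \<in> Y; y \<in> Y; z \<in> Y; x \<noteq> y; x \<noteq> z; y \<noteq> z\<rbrakk> \<Longrightarrow> B (x, z, y, z) = 1"
    and multiplicative_cross_ratio_cocycle:
      "\<lbrakk>x \<in> Y - {y, y'}; x' \<in> Y - {y, y'}; x'' \<in> Y - {y, y'}; y \<in> Y; y' \<in> Y; y \<noteq> y'\<rbrakk> \<Longrightarrow>
        B (x, y, x', y') = B (x, y, x'', y') * B (x'', y, x', y')"
  using assms unfolding multiplicative_cross_ratio_def by simp_all

lemma quadruples_iff: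
  "(a, b, c, d) \<in> quadruples Y \<longleftrightarrow> a \<in> Y \<and> b \<in> Y \<and> c \<in> Y \<and> d \<in> Y \<and>
     (b \<noteq> c \<and> b \<noteq> d \<and> c \<noteq> d \<or> a \<noteq> c \<and> a \<noteq> d \<and> c \<noteq> d \<or> a \<noteq> b \<and> a \<noteq> d \<and> b \<noteq> d \<or> a \<noteq> b \<and> a \<noteq> c \<and> b \<noteq> c)"
  by (cases "a = b"; cases "a = c"; cases "a = d"; cases "b = c"; cases "b = d"; cases "c = d")
    (simp_all add: quadruples_def card_insert_if)

lemma generates_topologyD:
  assumes "generates_topology T B" "{x, y, z} \<subseteq> topspace T" "distinct [x, y, z]"
  shows "\<epsilon> > 0 \<Longrightarrow> \<exists>U. openin T U \<and> x \<in> U \<and> U \<subseteq> {w \<in> topspace T. B (w, x, y, z) < ennreal \<epsilon>}"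
    and "openin T U \<Longrightarrow> x \<in> U \<Longrightarrow>
      \<exists>\<epsilon>>0. {w \<in> topspace T. B (w, x, y, z) < ennreal \<epsilon>} \<subseteq> U"
  using assms unfolding generates_topology_def by simp_all

text \<open>If \<open>(a, b)\<close> and \<open>(h, k)\<close> had different slopes, a rational m /
  n would separate a / h from b / k, and the element n (a, b) - m (h, k) would have coordinates of
  opposite signs. This is the classical argument that an order-preserving homomorphism between
  subgroups of the reals is multiplication by a constant.\<close>

lemma plane_subgroup_on_line:
  fixes A :: "(real \<times> real) set"
  assumes add: "\<And>a b. a \<in> A \<Longrightarrow> b \<in> A \<Longrightarrow> a + b \<in> A"
    and minus: "\<And>a. a \<in> A \<Longrightarrow> - a \<in> A"
    and neg: "\<And>a b. (a, b) \<in> A \<Longrightarrow> a < 0 \<longleftrightarrow> b < 0"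
  shows "\<exists>t>0. \<forall>(a, b)\<in>A. a = t * b"
proof -
  have pos: "a > 0 \<longleftrightarrow> b > 0" if "(a, b) \<in> A" for a b
    using minus[OF that] neg[of "- a" "- b"] by simp
  show ?thesis
  proof (cases "\<exists>(a, b)\<in>A. a \<noteq> 0")
    case False
    \<comment> \<open>All first coordinates vanish, hence by the sign condition all second ones too;
      the slope 1 is an arbitrary choice.\<close>
    have "a = 1 * b" if "(a, b) \<in> A" for a b
    proof -
      have "a = 0" using False that by auto
      then show ?thesis using pos[OF that] neg[OF that] by auto
    qed
    then show ?thesis by (intro exI[of _ 1]) auto
  next
    case True
    then obtain a0 b0 where "(a0, b0) \<in> A" "a0 \<noteq> 0" by auto
    then obtain h k where hk: "(h, k) \<in> A" "h > 0"
      using minus[of "(a0, b0)"] by (cases "a0 > 0") (auto simp: not_less less_le)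
    then have "k > 0" using pos by blast
    have "(0, 0) \<in> A" using add[OF hk(1) minus[OF hk(1)]] by (simp add: zero_prod_def)
    have nat_mult: "(real n * a, real n * b) \<in> A" if "(a, b) \<in> A" for n a b
    proof (induction n)
      case (Suc n)
      then show ?case using add[OF that Suc] by (simp add: algebra_simps)
    qed (use \<open>(0, 0) \<in> A\<close> in simp)
    have int_mult: "(of_int m * a, of_int m * b) \<in> A" if "(a, b) \<in> A" for m a b
      using nat_mult[OF that, of "nat m"] minus[OF nat_mult[OF that, of "nat (- m)"]]
      by (cases "m \<ge> 0") auto
    have "a / h = b / k" if "(a, b) \<in> A" for a b
    proof (rule ccontr)
      have comb: "(real n * a - of_int m * h, real n * b - of_int m * k) \<in> A" for n m
        using add[OF nat_mult[OF that] int_mult[OF hk(1)], of n "- m"] by simp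
      assume "a / h \<noteq> b / k"
      then obtain q where q: "q \<in> \<rat>" "a / h < q \<and> q < b / k \<or> b / k < q \<and> q < a / h"
        using Rats_dense_in_real by (metis linorder_neqE)
      from Rats_cases'[OF q(1)] obtain m n where mn: "n > 0" "q = of_int m / of_int n"
        by metis
      define n' where "n' = nat n"
      have n': "real n' > 0" "q = of_int m / real n'" using mn by (auto simp: n'_def)
      \<comment> \<open>The two numbers are \<open>n' * h * (a / h - q)\<close> and
        \<open>n' * k * (b / k - q)\<close>, and \<open>q\<close> lies strictly between the two
        quotients.\<close>
      have "sgn (real n' * a - of_int m * h) \<noteq> sgn (real n' * b - of_int m * k)"
        using q(2) n' \<open>h > 0\<close> \<open>k > 0\<close> by (auto simp: field_simps sgn_if)
      then show False using neg[OF comb[of n' m]] pos[OF comb[of n' m]] by (auto simp: sgn_if split: if_splits)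
    qed
    then have "a = (h / k) * b" if "(a, b) \<in> A" for a b
      using that \<open>h > 0\<close> \<open>k > 0\<close> by (auto simp: field_simps)
    then show ?thesis using \<open>h > 0\<close> \<open>k > 0\<close> by (intro exI[of _ "h / k"]) auto
  qed
qed

lemma ennreal_powr_simps [simp]:
  "ennreal_powr 0 t = 0" "ennreal_powr \<infinity> t = \<infinity>" "ennreal_powr 1 t = 1"
  by (auto simp: ennreal_powr_def)

text \<open>Separates the comparison from hyperbolic geometry: \<open>G\<close> is a set of
  injections of \<open>Y\<close> into itself, transitive on triples, and transitivity alone produces
  the group law on the pairs of logarithms.\<close>

proposition invariant_cross_ratio_power:
  fixes B C :: "'b \<times> 'b \<times> 'b \<times> 'b \<Rightarrow> ennreal" and T :: "'b topology"
  defines "Y \<equiv> topspace T"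
  assumes B: "multiplicative_cross_ratio Y B" and C: "multiplicative_cross_ratio Y C"
    and gen_B: "generates_topology T B" and gen_C: "generates_topology T C"
    and maps: "\<And>g. g \<in> G \<Longrightarrow> g ` Y \<subseteq> Y" and inj: "\<And>g. g \<in> G \<Longrightarrow> inj_on g Y"
    and trans: "\<And>x y z x' y' z'. \<lbrakk>{x, y, z, x', y', z'} \<subseteq> Y; distinct [x, y, z]; distinct [x', y', z']\<rbrakk>
      \<Longrightarrow> \<exists>g\<in>G. g x = x' \<and> g y = y' \<and> g z = z'"
    and inv_B: "\<And>g w x y z. g \<in> G \<Longrightarrow> (w, x, y, z) \<in> quadruples Y \<Longrightarrow>
      B (g w, g x, g y, g z) = B (w, x, y, z)"
    and inv_C: "\<And>g w x y z. g \<in> G \<Longrightarrow> (w, x, y, z) \<in> quadruples Y \<Longrightarrow>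
      C (g w, g x, g y, g z) = C (w, x, y, z)"
  shows "\<exists>t>0. \<forall>(w, x, y, z)\<in>quadruples Y. B (w, x, y, z) = ennreal_powr (C (w, x, y, z)) t"
proof (cases "quadruples Y = {}")
  case True
  then show ?thesis by (intro exI[of _ 1]) auto
next
  case False
  then obtain w x y z where "(w, x, y, z) \<in> quadruples Y" by auto
  then obtain o' e i where Y: "o' \<in> Y" "e \<in> Y" "i \<in> Y" and ne: "o' \<noteq> e" "o' \<noteq> i" "e \<noteq> i"
    unfolding quadruples_iff by metis
  define Z where "Z = Y - {o', i}"
  define N where "N D w = enn2real (D (w, o', e, i))" for D :: "'b \<times> 'b \<times> 'b \<times> 'b \<Rightarrow> ennreal" and w
  have eZ: "e \<in> Z" using Y ne by (auto simp: Z_def)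
  have gZ: "g v \<in> Z" if "g \<in> G" "g o' = o'" "g i = i" "v \<in> Z" for g v
    using maps[OF that(1)] inj_onD[OF inj[OF that(1)], of v o'] inj_onD[OF inj[OF that(1)], of v i]
      that(2-4) Y by (auto simp: Z_def)
  have mult: "N D (g w) = N D w * N D (g e)"
    and pos: "N D w > 0" and enn: "D (w, o', e, i) = ennreal (N D w)" and one: "N D e = 1"
    if "D \<in> {B, C}"
      and w: "w \<in> Z" and g: "g \<in> G" "g o' = o'" "g i = i" for D w g
  proof -
    have D: "multiplicative_cross_ratio Y D" using \<open>D \<in> {B, C}\<close> B C by auto
    have inv: "D (g w, g x, g y, g z) = D (w, x, y, z)" if "(w, x, y, z) \<in> quadruples Y" for w x y z
      using \<open>D \<in> {B, C}\<close> inv_B[OF g(1) that] inv_C[OF g(1) that] by auto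
    have Q: "(w, o', e, i) \<in> quadruples Y" using Y ne w by (auto simp: quadruples_iff Z_def)
    have pos': "N D w > 0" "D (w, o', e, i) = ennreal (N D w)" if "w \<in> Z" for w
    proof -
      have "(w, o', e, i) \<in> quadruples Y" using Y ne that by (auto simp: quadruples_iff Z_def)
      then have "D (w, o', e, i) \<noteq> 0" "D (w, o', e, i) \<noteq> \<infinity>"
        using multiplicative_cross_ratio_eq_0[OF D] multiplicative_cross_ratio_eq_top[OF D] that ne
        by (auto simp: Z_def)
      then show "N D w > 0" "D (w, o', e, i) = ennreal (N D w)"
        unfolding N_def by (simp_all add: enn2real_positive_iff less_top zero_less_iff_neq_zero)
    qed
    show "N D w > 0" "D (w, o', e, i) = ennreal (N D w)" using pos'[OF w] by auto
    have coc: "D (u, o', v, i) = D (u, o', v', i) * D (v', o', v, i)"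
      if "u \<in> Z" "v \<in> Z" "v' \<in> Z" for u v v'
      using multiplicative_cross_ratio_cocycle[OF D, of u o' i v v'] that Y ne by (simp add: Z_def)
    \<comment> \<open>The cocycle rule is applied with intermediate point \<open>g e\<close>; as
      \<open>g\<close> fixes \<open>o'\<close> and \<open>i\<close>, the first factor is the value
      at the image of \<open>(w, o', e, i)\<close>, which invariance evaluates.\<close>
    have "D (g w, o', e, i) = D (g w, g o', g e, g i) * D (g e, o', e, i)"
      using coc[OF gZ[OF g w] eZ gZ[OF g eZ]] g by simp
    also have "D (g w, g o', g e, g i) = D (w, o', e, i)" using inv[OF Q] .
    finally show "N D (g w) = N D w * N D (g e)" by (simp add: N_def enn2real_mult)
    have "N D e = N D e * N D e" using coc[OF eZ eZ eZ] by (simp add: N_def flip: enn2real_mult)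
    then show "N D e = 1" using pos'(1)[OF eZ] by simp
  qed
  \<comment> \<open>\<open>g0\<close> merely instantiates the parameter \<open>g\<close> in the
    facts on positivity, finiteness and normalisation, whose conclusions do not mention it.\<close>
  obtain g0 where g0: "g0 \<in> G" "g0 o' = o'" "g0 i = i" using trans[of o' i e o' i e] Y ne by auto
  have BC: "B \<in> {B, C}" "C \<in> {B, C}" by auto
  note NB = pos[OF BC(1) _ g0] enn[OF BC(1) _ g0] one[OF BC(1) eZ g0]
  note NC = pos[OF BC(2) _ g0] enn[OF BC(2) _ g0] one[OF BC(2) eZ g0]
  have move: "\<exists>g\<in>G. g o' = o' \<and> g i = i \<and> g v = w" if "v \<in> Z" "w \<in> Z" for v w
    using trans[of o' i v o' i w] that Y ne by (auto simp: Z_def)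
  define A where "A = (\<lambda>w. (ln (N B w), ln (N C w))) ` Z"
  \<comment> \<open>The sum of the pairs of \<open>v\<close> and \<open>w\<close> is the pair of
    \<open>g v\<close>, where \<open>g\<close> carries \<open>e\<close> to \<open>w\<close>. For
    negation below, \<open>g\<close> carries \<open>w\<close> back to \<open>e\<close>, and the pair
    of \<open>g e\<close> is the opposite of that of \<open>w\<close>.\<close>
  have A_add: "a + b \<in> A" if ab: "a \<in> A" "b \<in> A" for a b
  proof -
    obtain v w where vw: "v \<in> Z" "w \<in> Z" and eq: "a = (ln (N B v), ln (N C v))" "b = (ln (N B w), ln (N C w))"
      using ab by (auto simp: A_def)
    obtain g where g: "g \<in> G" "g o' = o'" "g i = i" "g e = w" using move[OF eZ vw(2)] by auto
    have "N B (g v) = N B v * N B w" "N C (g v) = N C v * N C w"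
      using mult[OF BC(1) vw(1) g(1-3)] mult[OF BC(2) vw(1) g(1-3)] g(4) by auto
    then have "a + b = (ln (N B (g v)), ln (N C (g v)))"
      using NB(1)[OF vw(1)] NB(1)[OF vw(2)] NC(1)[OF vw(1)] NC(1)[OF vw(2)]
      by (simp add: eq ln_mult_pos)
    then show ?thesis using gZ[OF g(1-3) vw(1)] by (auto simp: A_def)
  qed
  have A_minus: "- a \<in> A" if a: "a \<in> A" for a
  proof -
    obtain w where w: "w \<in> Z" and eq: "a = (ln (N B w), ln (N C w))"
      using a by (auto simp: A_def)
    obtain g where g: "g \<in> G" "g o' = o'" "g i = i" "g w = e" using move[OF w eZ] by auto
    have "N B w * N B (g e) = 1" "N C w * N C (g e) = 1"
      using mult[OF BC(1) w g(1-3)] mult[OF BC(2) w g(1-3)] g(4) NB(3) NC(3) by auto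
    then have "N B (g e) = inverse (N B w)" "N C (g e) = inverse (N C w)"
      using inverse_unique by metis+
    then have "- a = (ln (N B (g e)), ln (N C (g e)))"
      using NB(1)[OF w] NC(1)[OF w] by (simp add: eq ln_inverse)
    then show ?thesis using gZ[OF g(1-3) eZ] by (auto simp: A_def)
  qed
  text \<open>Iterating an element that contracts towards \<open>o'\<close> for one cross-ratio gives points that
    converge to \<open>o'\<close> in the topology, hence it contracts for the other one as well.\<close>
  have contract: "ln (N D' w) < 0"
    if gen: "generates_topology T D" "generates_topology T D'"
      and D: "\<And>w. w \<in> Z \<Longrightarrow> N D w > 0" "\<And>w. w \<in> Z \<Longrightarrow> D (w, o', e, i) = ennreal (N D w)"
      and D': "\<And>w. w \<in> Z \<Longrightarrow> N D' w > 0" "\<And>w. w \<in> Z \<Longrightarrow> D' (w, o', e, i) = ennreal (N D' w)"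
      and it: "\<And>n. \<exists>v\<in>Z. ln (N D v) = real n * ln (N D w) \<and> ln (N D' v) = real n * ln (N D' w)"
      and w: "ln (N D w) < 0" for D D' w
  proof -
    have oei: "{o', e, i} \<subseteq> topspace T" "distinct [o', e, i]" using Y ne by (auto simp: Y_def)
    \<comment> \<open>The threshold 1 is chosen because a value below 1 has a negative
      logarithm.\<close>
    obtain U where U: "openin T U" "o' \<in> U" "U \<subseteq> {w \<in> Y. D' (w, o', e, i) < ennreal 1}"
      using generates_topologyD(1)[OF gen(2) oei zero_less_one] by (auto simp: Y_def)
    obtain \<epsilon> :: real where \<epsilon>: "\<epsilon> > 0" "{w \<in> Y. D (w, o', e, i) < ennreal \<epsilon>} \<subseteq> U"
      using generates_topologyD(2)[OF gen(1) oei U(1,2)] by (auto simp: Y_def)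
    \<comment> \<open>This multiple pushes the logarithm for \<open>D\<close> below
      \<open>ln \<epsilon>\<close>, which forces the corresponding point \<open>v\<close> into
      \<open>U\<close>.\<close>
    obtain n where n: "- ln \<epsilon> < real n * (- ln (N D w))"
      using reals_Archimedean3 w by (metis neg_0_less_iff_less)
    obtain v where v: "v \<in> Z" "ln (N D v) = real n * ln (N D w)" "ln (N D' v) = real n * ln (N D' w)"
      using it by blast
    have "ln (N D v) < ln \<epsilon>" using n v by simp
    then have "N D v < \<epsilon>" using D(1)[OF v(1)] \<epsilon>(1) by simp
    then have "v \<in> U" using \<epsilon> v(1) D(1,2)[OF v(1)] by (auto simp: Z_def ennreal_less_iff)
    then have "D' (v, o', e, i) < ennreal 1" using U(3) by blast
    then have "N D' v < 1" using D'(1,2)[OF v(1)] by (simp add: ennreal_less_iff del: ennreal_1)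
    then have "real n * ln (N D' w) < 0" unfolding v(3)[symmetric] using D'(1)[OF v(1)] by simp
    then show ?thesis by (simp add: mult_less_0_iff)
  qed
  \<comment> \<open>The iterates are taken in \<open>A\<close>: closure under addition makes every
    multiple of the pair of \<open>w\<close> the pair of some point, without forming powers of a
    map.\<close>
  have iterate: "\<exists>v\<in>Z. ln (N B v) = real n * ln (N B w) \<and> ln (N C v) = real n * ln (N C w)"
    if w: "w \<in> Z" for w n
  proof -
    have "(real n * ln (N B w), real n * ln (N C w)) \<in> A"
    proof (induction n)
      case 0
      show ?case using eZ NB(3) NC(3) by (auto simp: A_def intro!: rev_image_eqI[of e])
    next
      case (Suc n)
      from A_add[OF this, of "(ln (N B w), ln (N C w))"] w show ?case
        by (auto simp: A_def algebra_simps)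
    qed
    then show ?thesis by (auto simp: A_def)
  qed
  have neg: "a < 0 \<longleftrightarrow> b < 0" if ab: "(a, b) \<in> A" for a b
  proof -
    obtain w where w: "w \<in> Z" "a = ln (N B w)" "b = ln (N C w)" using ab by (auto simp: A_def)
    have it': "\<exists>v\<in>Z. ln (N C v) = real n * ln (N C w) \<and> ln (N B v) = real n * ln (N B w)" for n
      using iterate[OF w(1)] by blast
    show ?thesis
      using contract[OF gen_B gen_C NB(1,2) NC(1,2) iterate[OF w(1)]]
        contract[OF gen_C gen_B NC(1,2) NB(1,2) it'] w(2,3) by blast
  qed
  obtain t where t: "t > 0" "\<forall>(a, b)\<in>A. a = t * b"
    using plane_subgroup_on_line[OF A_add A_minus neg] by blast
  have std: "B (w, o', e, i) = ennreal_powr (C (w, o', e, i)) t" if w: "w \<in> Y" for w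
  proof (cases "w \<in> Z")
    case True
    have "ln (N B w) = t * ln (N C w)" using t(2) True by (auto simp: A_def)
    then have "exp (ln (N B w)) = N C w powr t" using NC(1)[OF True] by (simp add: powr_def)
    then have "N B w = N C w powr t" using NB(1)[OF True] by simp
    then show ?thesis using NB(2)[OF True] NC(1,2)[OF True] by (simp add: ennreal_powr_def less_imp_le)
  next
    case False
    then have "w = o' \<or> w = i" using w by (auto simp: Z_def)
    moreover have "(o', o', e, i) \<in> quadruples Y" "(i, o', e, i) \<in> quadruples Y"
      using Y ne by (auto simp: quadruples_iff)
    ultimately show ?thesis
      using multiplicative_cross_ratio_eq_0[OF B] multiplicative_cross_ratio_eq_top[OF B]
        multiplicative_cross_ratio_eq_0[OF C] multiplicative_cross_ratio_eq_top[OF C] ne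
      by (metis ennreal_powr_simps(1,2))
  qed
  have "B (w, x, y, z) = ennreal_powr (C (w, x, y, z)) t" if q: "(w, x, y, z) \<in> quadruples Y" for w x y z
  proof -
    have mem: "w \<in> Y" "x \<in> Y" "y \<in> Y" "z \<in> Y" using q by (auto simp: quadruples_iff)
    \<comment> \<open>Distinct \<open>x\<close>, \<open>y\<close>, \<open>z\<close> can be moved to
      \<open>o'\<close>, \<open>e\<close>, \<open>i\<close>, with \<open>w\<close> going to an
      arbitrary point covered by \<open>std\<close>. A coincidence among them forces the value
      infinity, 0 or 1, each fixed by \<open>ennreal_powr\<close>.\<close>
    consider "x = y" | "y = z" | "x = z" "w \<noteq> y" "w \<noteq> z" "y \<noteq> z" | "distinct [x, y, z]"
      using q by (auto simp: quadruples_iff)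
    then show ?thesis
    proof cases
      case 1
      then have "B (w, x, y, z) = \<infinity>" "C (w, x, y, z) = \<infinity>"
        using multiplicative_cross_ratio_eq_top[OF B q] multiplicative_cross_ratio_eq_top[OF C q] by auto
      then show ?thesis by (simp only: ennreal_powr_simps)
    next
      case 2
      then have "B (w, x, y, z) = 0" "C (w, x, y, z) = 0"
        using multiplicative_cross_ratio_eq_0[OF B q] multiplicative_cross_ratio_eq_0[OF C q] by auto
      then show ?thesis by simp
    next
      case 3
      then have "B (w, x, y, z) = 1" "C (w, x, y, z) = 1"
        using mem multiplicative_cross_ratio_eq_1[OF B] multiplicative_cross_ratio_eq_1[OF C] by auto
      then show ?thesis by simp
    next
      case 4
      then obtain g where g: "g \<in> G" "g x = o'" "g y = e" "g z = i"
        using trans[of x y z o' e i] mem Y ne by auto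
      have "g w \<in> Y" using maps[OF g(1)] mem by auto
      from std[OF this] show ?thesis using inv_B[OF g(1) q] inv_C[OF g(1) q] g by simp
    qed
  qed
  then show ?thesis using t(1) by (intro exI[of _ t]) auto
qed

section \<open>The boundary of a strongly hyperbolic space\<close>

lemma gromov_dist_pos [simp]: "gromov_dist p x y > 0"
  by (simp add: gromov_dist_def)

lemma gromov_dist_commute: "gromov_dist p x y = gromov_dist p y x"
  by (simp add: gromov_dist_def gromov_product_def dist_commute add.commute)

lemma gromov_dist_le_1: "gromov_dist p x y \<le> 1"
  using dist_triangle2[of x y p] by (simp add: gromov_dist_def gromov_product_def dist_commute)

lemma gromov_dist_base_change: "gromov_dist q x y \<le> exp (dist p q) * gromov_dist p x y"
proof -
  have "gromov_product p x y - dist p q \<le> gromov_product q x y"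
    using dist_triangle[of p x q] dist_triangle[of p y q] by (simp add: gromov_product_def field_simps)
  then show ?thesis by (simp add: gromov_dist_def flip: exp_add)
qed

lemma gromov_dist_isometry:
  assumes "\<And>x y. dist (g x) (g y) = dist x y"
  shows "gromov_dist (g p) (g x) (g y) = gromov_dist p x y"
  by (simp add: assms gromov_dist_def gromov_product_def)

lemma gromov_product_at_top_iff:
  "filterlim (\<lambda>(i, j). gromov_product p (s i) (t j)) at_top F \<longleftrightarrow>
   ((\<lambda>(i, j). gromov_dist p (s i) (t j)) \<longlongrightarrow> 0) F"
proof -
  have "((\<lambda>(i, j). gromov_dist p (s i) (t j)) \<longlongrightarrow> 0) F \<longleftrightarrow>
        filterlim (\<lambda>(i, j). gromov_dist p (s i) (t j)) (at_right 0) F"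
    by (auto simp: filterlim_at case_prod_unfold intro!: always_eventually less_imp_neq[symmetric])
  also have "\<dots> \<longleftrightarrow> filterlim (\<lambda>x. - gromov_product p (s (fst x)) (t (snd x))) at_bot F" (is "?A \<longleftrightarrow> ?B")
  proof
    assume ?A
    then have "filterlim (\<lambda>x. ln (gromov_dist p (s (fst x)) (t (snd x)))) at_bot F"
      by (intro filterlim_compose[OF ln_at_0]) (simp add: case_prod_unfold)
    then show ?B by (simp add: gromov_dist_def)
  next
    assume ?B
    then have "((\<lambda>x. exp (- gromov_product p (s (fst x)) (t (snd x)))) \<longlongrightarrow> 0) F"
      by (rule filterlim_compose[OF exp_at_bot])
    then show ?A by (auto simp: filterlim_at case_prod_unfold gromov_dist_def intro!: always_eventually)
  qed
  also have "\<dots> \<longleftrightarrow> filterlim (\<lambda>(i, j). gromov_product p (s i) (t j)) at_top F"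
    by (simp add: filterlim_uminus_at_top case_prod_unfold)
  finally show ?thesis ..
qed

lemma gromov_product_at_top_iff_eventually:
  "filterlim (\<lambda>(i, j). gromov_product p (s i) (t j)) at_top (sequentially \<times>\<^sub>F sequentially) \<longleftrightarrow>
   (\<forall>r>0. \<exists>N. \<forall>i\<ge>N. \<forall>j\<ge>N. gromov_dist p (s i) (t j) < r)"
  unfolding gromov_product_at_top_iff
  by (simp add: tendsto_iff eventually_prod_sequentially abs_of_pos) blast

text \<open>Raising to the power \<epsilon> is an increasing bijection of the positive reals, so
  bounds translate by replacing \<open>r\<close> with \<open>r powr \<epsilon>\<close> or
  \<open>r powr (1 / \<epsilon>)\<close>.\<close>

lemma powr_small_iff:
  fixes \<epsilon> :: real and f :: "nat \<Rightarrow> nat \<Rightarrow> real"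
  assumes "\<epsilon> > 0" "\<And>i j. f i j > 0"
  shows "(\<forall>r>0. \<exists>N. \<forall>i\<ge>N. \<forall>j\<ge>N. f i j powr \<epsilon> < r) \<longleftrightarrow> (\<forall>r>0. \<exists>N. \<forall>i\<ge>N. \<forall>j\<ge>N. f i j < r)"
proof -
  have A: "f i j powr \<epsilon> < r powr \<epsilon> \<longleftrightarrow> f i j < r" if "r > 0" for i j r
    using assms that by (smt (verit) powr_less_mono2 powr_mono2)
  have B: "r = (r powr (1 / \<epsilon>)) powr \<epsilon>" if "r > 0" for r
    using assms(1) that by (simp add: powr_powr)
  show ?thesis
  proof (intro iffI allI impI)
    fix r :: real assume "\<forall>r>0. \<exists>N. \<forall>i\<ge>N. \<forall>j\<ge>N. f i j powr \<epsilon> < r" and r: "r > 0"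
    then have "\<exists>N. \<forall>i\<ge>N. \<forall>j\<ge>N. f i j powr \<epsilon> < r powr \<epsilon>" by simp
    then show "\<exists>N. \<forall>i\<ge>N. \<forall>j\<ge>N. f i j < r" using A[OF r] by simp
  next
    fix r :: real assume "\<forall>r>0. \<exists>N. \<forall>i\<ge>N. \<forall>j\<ge>N. f i j < r" and r: "r > 0"
    then have "\<exists>N. \<forall>i\<ge>N. \<forall>j\<ge>N. f i j < r powr (1 / \<epsilon>)" by simp
    then show "\<exists>N. \<forall>i\<ge>N. \<forall>j\<ge>N. f i j powr \<epsilon> < r"
      using A[of "r powr (1 / \<epsilon>)"] r B[OF r] by simp
  qed
qed

section \<open>The boundary distance as a limit, and its metric properties\<close>

locale strongly_eps_hyperbolic_space =
  fixes X :: "'a::metric_space itself" and \<epsilon> :: real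
  assumes eps_pos: "\<epsilon> > 0" and hyperbolic: "strongly_eps_hyperbolic TYPE('a) \<epsilon>"
begin

text \<open>The power for which strong hyperbolicity is a genuine triangle inequality. It is not a
  metric on the space, as \<open>\<delta> p x x = exp (- \<epsilon> * dist p x)\<close> is positive;
  the diagonal value tends to 0 only at infinity.\<close>

definition \<delta> :: "'a \<Rightarrow> 'a \<Rightarrow> 'a \<Rightarrow> real" where
  "\<delta> p x y = gromov_dist p x y powr \<epsilon>"

lemma \<delta>_pos [simp]: "\<delta> p x y > 0"
  using gromov_dist_pos[of p x y] by (simp add: \<delta>_def del: gromov_dist_pos)

lemma \<delta>_commute: "\<delta> p x y = \<delta> p y x"
  by (simp add: \<delta>_def gromov_dist_commute)

lemma \<delta>_triangle: "\<delta> p x z \<le> \<delta> p x y + \<delta> p y z"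
  using hyperbolic by (simp add: \<delta>_def strongly_eps_hyperbolic_def)

lemma \<delta>_quadrilateral: "\<bar>\<delta> p x y - \<delta> p x' y'\<bar> \<le> \<delta> p x x' + \<delta> p y y'"
  using \<delta>_triangle[of p x y x'] \<delta>_triangle[of p x' y y'] \<delta>_triangle[of p x' y' x] \<delta>_triangle[of p x y' y]
    \<delta>_commute[of p x x'] \<delta>_commute[of p y y'] by linarith

lemma gromov_product_at_top_iff_\<delta>:
  "filterlim (\<lambda>(i, j). gromov_product p (s i) (t j)) at_top (sequentially \<times>\<^sub>F sequentially) \<longleftrightarrow>
   (\<forall>r>0. \<exists>N. \<forall>i\<ge>N. \<forall>j\<ge>N. \<delta> p (s i) (t j) < r)"
  unfolding gromov_product_at_top_iff_eventually \<delta>_def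
  by (rule powr_small_iff[OF eps_pos, symmetric]) simp

text \<open>Transitivity is the triangle inequality for \<delta> through a single late term of the
  middle sequence; reflexivity is convergence to infinity itself.\<close>

lemma equiv_boundary_rel: "equiv {s. converges_to_infinity s} (boundary_rel :: ((nat \<Rightarrow> 'a) \<times> _) set)"
proof (rule equivI)
  show "sym (boundary_rel :: ((nat \<Rightarrow> 'a) \<times> _) set)"
    unfolding sym_def boundary_rel_def gromov_product_at_top_iff_\<delta>
    by (simp add: \<delta>_commute) (metis \<delta>_commute)
  show "trans (boundary_rel :: ((nat \<Rightarrow> 'a) \<times> _) set)"
  proof (rule transI)
    fix s t u :: "nat \<Rightarrow> 'a"
    assume st: "(s, t) \<in> boundary_rel" and tu: "(t, u) \<in> boundary_rel"
    have "\<exists>N. \<forall>i\<ge>N. \<forall>j\<ge>N. \<delta> p (s i) (u j) < r" if "r > 0" for p and r :: real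
    proof -
      obtain M where M: "\<forall>i\<ge>M. \<forall>j\<ge>M. \<delta> p (s i) (t j) < r / 2"
        using st \<open>r > 0\<close> unfolding boundary_rel_def gromov_product_at_top_iff_\<delta>
        by (auto dest!: spec[of _ p] spec[of _ "r / 2"])
      obtain N where N: "\<forall>i\<ge>N. \<forall>j\<ge>N. \<delta> p (t i) (u j) < r / 2"
        using tu \<open>r > 0\<close> unfolding boundary_rel_def gromov_product_at_top_iff_\<delta>
        by (auto dest!: spec[of _ p] spec[of _ "r / 2"])
      have "\<delta> p (s i) (u j) < r" if "i \<ge> max M N" "j \<ge> max M N" for i j
        using M[rule_format, of i "max M N"] N[rule_format, of "max M N" j] that
          \<delta>_triangle[of p "s i" "u j" "t (max M N)"] by simp
      then show ?thesis by blast
    qed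
    then show "(s, u) \<in> boundary_rel"
      using st tu by (auto simp: boundary_rel_def gromov_product_at_top_iff_\<delta>)
  qed
qed (auto simp: boundary_rel_def converges_to_infinity_def refl_on_def)

lemma gromov_boundary_nonempty: "\<xi> \<in> gromov_boundary \<Longrightarrow> \<exists>s::nat \<Rightarrow> 'a. s \<in> \<xi>"
  using in_quotient_imp_non_empty[OF equiv_boundary_rel] unfolding gromov_boundary_def by blast

lemma gromov_boundary_eq_iff:
  fixes \<xi> \<eta> :: "(nat \<Rightarrow> 'a) set"
  shows "\<lbrakk>\<xi> \<in> gromov_boundary; \<eta> \<in> gromov_boundary; s \<in> \<xi>; t \<in> \<eta>\<rbrakk> \<Longrightarrow> \<xi> = \<eta> \<longleftrightarrow> (s, t) \<in> boundary_rel"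
  unfolding gromov_boundary_def by (rule quotient_eq_iff[OF equiv_boundary_rel])

lemma representatives_close:
  fixes \<xi> :: "(nat \<Rightarrow> 'a) set"
  assumes "\<xi> \<in> gromov_boundary" "s \<in> \<xi>" "s' \<in> \<xi>" "r > 0"
  shows "\<exists>N. \<forall>i\<ge>N. \<forall>j\<ge>N. \<delta> p (s i) (s' j) < r"
  using gromov_boundary_eq_iff[OF assms(1,1,2,3)] assms(4)
  by (simp add: boundary_rel_def gromov_product_at_top_iff_\<delta>)

text \<open>The four indices are independent, so the same estimate gives the Cauchy property (equal
  sequences) and independence of the representatives (different ones).\<close>

lemma double_sequences_close:
  fixes \<xi> \<eta> :: "(nat \<Rightarrow> 'a) set"
  assumes "\<xi> \<in> gromov_boundary" "\<eta> \<in> gromov_boundary" "s \<in> \<xi>" "s' \<in> \<xi>" "t \<in> \<eta>" "t' \<in> \<eta>" "r > 0"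
  shows "\<exists>N. \<forall>i\<ge>N. \<forall>j\<ge>N. \<forall>k\<ge>N. \<forall>l\<ge>N. \<bar>\<delta> p (s i) (t j) - \<delta> p (s' k) (t' l)\<bar> < r"
proof -
  obtain M where M: "\<forall>i\<ge>M. \<forall>j\<ge>M. \<delta> p (s i) (s' j) < r / 2"
    using representatives_close[OF assms(1,3,4), of "r / 2" p] assms(7) by (meson half_gt_zero)
  obtain N where N: "\<forall>i\<ge>N. \<forall>j\<ge>N. \<delta> p (t i) (t' j) < r / 2"
    using representatives_close[OF assms(2,5,6), of "r / 2" p] assms(7) by (meson half_gt_zero)
  have "\<bar>\<delta> p (s i) (t j) - \<delta> p (s' k) (t' l)\<bar> < r"
    if "i \<ge> max M N" "j \<ge> max M N" "k \<ge> max M N" "l \<ge> max M N" for i j k l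
    using M[rule_format, of i k] N[rule_format, of j l] that
      \<delta>_quadrilateral[of p "s i" "t j" "s' k" "t' l"] by simp
  then show ?thesis by blast
qed

text \<open>One \<open>l\<close> must serve all representatives, as the definite description in
  \<open>boundary_dist\<close> demands. It is the limit of the real Cauchy sequence on the diagonal
  of one chosen pair, with which every other pair is compared.\<close>

lemma \<delta>_limit_exists:
  fixes \<xi> \<eta> :: "(nat \<Rightarrow> 'a) set"
  assumes \<xi>: "\<xi> \<in> gromov_boundary" and \<eta>: "\<eta> \<in> gromov_boundary"
  shows "\<exists>l. \<forall>s\<in>\<xi>. \<forall>t\<in>\<eta>. ((\<lambda>(i, j). \<delta> p (s i) (t j)) \<longlongrightarrow> l) (sequentially \<times>\<^sub>F sequentially)"
proof -
  obtain s t where s: "s \<in> \<xi>" and t: "t \<in> \<eta>" using gromov_boundary_nonempty assms by blast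
  have "Cauchy (\<lambda>n. \<delta> p (s n) (t n))"
    unfolding Cauchy_def dist_real_def
  proof (intro allI impI)
    fix r :: real assume "r > 0"
    then show "\<exists>N. \<forall>m\<ge>N. \<forall>n\<ge>N. \<bar>\<delta> p (s m) (t m) - \<delta> p (s n) (t n)\<bar> < r"
      using double_sequences_close[OF \<xi> \<eta> s s t t, of r p] by meson
  qed
  then obtain l where l: "(\<lambda>n. \<delta> p (s n) (t n)) \<longlonglongrightarrow> l" using Cauchy_convergent convergentD by blast
  have "((\<lambda>(i, j). \<delta> p (s' i) (t' j)) \<longlongrightarrow> l) (sequentially \<times>\<^sub>F sequentially)"
    if s': "s' \<in> \<xi>" and t': "t' \<in> \<eta>" for s' t'
  proof (rule tendstoI)
    fix r :: real assume "r > 0"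
    then obtain M where M: "\<forall>i\<ge>M. \<forall>j\<ge>M. \<forall>k\<ge>M. \<forall>l\<ge>M. \<bar>\<delta> p (s' i) (t' j) - \<delta> p (s k) (t l)\<bar> < r / 2"
      using double_sequences_close[OF \<xi> \<eta> s' s t' t, of "r / 2" p] by (meson half_gt_zero)
    obtain N where N: "\<forall>n\<ge>N. \<bar>\<delta> p (s n) (t n) - l\<bar> < r / 2"
      using LIMSEQ_D[OF l, of "r / 2"] \<open>r > 0\<close> by auto
    have "\<bar>\<delta> p (s' i) (t' j) - l\<bar> < r" if "i \<ge> max M N" "j \<ge> max M N" for i j
    proof -
      have "\<bar>\<delta> p (s' i) (t' j) - \<delta> p (s (max M N)) (t (max M N))\<bar> < r / 2" using M that by simp
      moreover have "\<bar>\<delta> p (s (max M N)) (t (max M N)) - l\<bar> < r / 2" using N by simp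
      ultimately show ?thesis by linarith
    qed
    then show "\<forall>\<^sub>F x in sequentially \<times>\<^sub>F sequentially. dist (case x of (i, j) \<Rightarrow> \<delta> p (s' i) (t' j)) l < r"
      by (auto simp: eventually_prod_sequentially dist_real_def intro!: exI[of _ "max M N"])
  qed
  then show ?thesis by blast
qed

lemma boundary_dist_limit:
  fixes \<xi> \<eta> :: "(nat \<Rightarrow> 'a) set"
  assumes \<xi>: "\<xi> \<in> gromov_boundary" and \<eta>: "\<eta> \<in> gromov_boundary" and s: "s \<in> \<xi>" and t: "t \<in> \<eta>"
  shows "((\<lambda>(i, j). gromov_dist p (s i) (t j)) \<longlongrightarrow> boundary_dist p \<xi> \<eta>) (sequentially \<times>\<^sub>F sequentially)"
proof -
  let ?F = "sequentially \<times>\<^sub>F sequentially"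
  obtain l where l: "\<And>s t. \<lbrakk>s \<in> \<xi>; t \<in> \<eta>\<rbrakk> \<Longrightarrow> ((\<lambda>(i, j). \<delta> p (s i) (t j)) \<longlongrightarrow> l) ?F"
    using \<delta>_limit_exists[OF \<xi> \<eta>] by blast
  have lim: "((\<lambda>(i, j). gromov_dist p (s i) (t j)) \<longlongrightarrow> l powr (1 / \<epsilon>)) ?F"
    if "s \<in> \<xi>" "t \<in> \<eta>" for s t
  proof -
    have "((\<lambda>x. (\<delta> p (s (fst x)) (t (snd x))) powr (1 / \<epsilon>)) \<longlongrightarrow> l powr (1 / \<epsilon>)) ?F"
      using l[OF that] eps_pos by (intro tendsto_powr' tendsto_const) (auto simp: case_prod_unfold less_imp_le)
    then show ?thesis using eps_pos by (simp add: \<delta>_def powr_powr case_prod_unfold less_imp_le)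
  qed
  have "boundary_dist p \<xi> \<eta> = l powr (1 / \<epsilon>)"
    unfolding boundary_dist_def
  proof (rule the_equality)
    show "\<forall>s\<in>\<xi>. \<forall>t\<in>\<eta>. ((\<lambda>(i, j). gromov_dist p (s i) (t j)) \<longlongrightarrow> l powr (1 / \<epsilon>)) ?F"
      using lim by blast
    show "m = l powr (1 / \<epsilon>)"
      if "\<forall>s\<in>\<xi>. \<forall>t\<in>\<eta>. ((\<lambda>(i, j). gromov_dist p (s i) (t j)) \<longlongrightarrow> m) ?F" for m
      using tendsto_unique[OF _ _ lim[OF s t], of m] that s t by (auto simp: prod_filter_eq_bot)
  qed
  then show ?thesis using lim[OF s t] by simp
qed

lemma boundary_dist_diagonal_limit:
  fixes \<xi> \<eta> :: "(nat \<Rightarrow> 'a) set"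
  assumes "\<xi> \<in> gromov_boundary" "\<eta> \<in> gromov_boundary" "s \<in> \<xi>" "t \<in> \<eta>"
  shows "(\<lambda>n. gromov_dist p (s n) (t n)) \<longlonglongrightarrow> boundary_dist p \<xi> \<eta>"
  using filterlim_compose[OF boundary_dist_limit[OF assms] filterlim_Pair[OF filterlim_ident filterlim_ident]]
  by simp

lemma
  fixes \<xi> \<eta> :: "(nat \<Rightarrow> 'a) set"
  assumes \<xi>: "\<xi> \<in> gromov_boundary" and \<eta>: "\<eta> \<in> gromov_boundary"
  shows boundary_dist_nonneg: "boundary_dist p \<xi> \<eta> \<ge> 0"
    and boundary_dist_le_1: "boundary_dist p \<xi> \<eta> \<le> 1"
    and boundary_dist_commute: "boundary_dist p \<xi> \<eta> = boundary_dist p \<eta> \<xi>"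
    and boundary_dist_base_change: "boundary_dist q \<xi> \<eta> \<le> exp (dist p q) * boundary_dist p \<xi> \<eta>"
proof -
  obtain s t where s: "s \<in> \<xi>" and t: "t \<in> \<eta>"
    using gromov_boundary_nonempty \<xi> \<eta> by blast
  note lim = boundary_dist_diagonal_limit[OF \<xi> \<eta> s t]
  show "boundary_dist p \<xi> \<eta> \<ge> 0"
    by (rule tendsto_lowerbound[OF lim]) (auto simp: less_imp_le)
  show "boundary_dist p \<xi> \<eta> \<le> 1"
    by (rule tendsto_upperbound[OF lim]) (auto simp: gromov_dist_le_1)
  show "boundary_dist p \<xi> \<eta> = boundary_dist p \<eta> \<xi>"
    using lim[of p] boundary_dist_diagonal_limit[OF \<eta> \<xi> t s, of p]
    by (simp add: gromov_dist_commute[of p "s _"] LIMSEQ_unique)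
  show "boundary_dist q \<xi> \<eta> \<le> exp (dist p q) * boundary_dist p \<xi> \<eta>"
    by (rule tendsto_le[OF _ tendsto_mult[OF tendsto_const lim] lim])
      (auto simp: gromov_dist_base_change)
qed

lemma boundary_dist_triangle:
  fixes \<xi> \<eta> \<zeta> :: "(nat \<Rightarrow> 'a) set"
  assumes \<xi>: "\<xi> \<in> gromov_boundary" and \<eta>: "\<eta> \<in> gromov_boundary" and \<zeta>: "\<zeta> \<in> gromov_boundary"
  shows "boundary_dist p \<xi> \<zeta> powr \<epsilon> \<le> boundary_dist p \<xi> \<eta> powr \<epsilon> + boundary_dist p \<eta> \<zeta> powr \<epsilon>"
proof -
  obtain s t u where s: "s \<in> \<xi>" and t: "t \<in> \<eta>" and u: "u \<in> \<zeta>"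
    using gromov_boundary_nonempty[OF \<xi>] gromov_boundary_nonempty[OF \<eta>] gromov_boundary_nonempty[OF \<zeta>] by blast
  have pw: "(\<lambda>n. \<delta> p (s n) (t n)) \<longlonglongrightarrow> boundary_dist p \<xi> \<eta> powr \<epsilon>"
    if "\<xi> \<in> gromov_boundary" "\<eta> \<in> gromov_boundary" "s \<in> \<xi>" "t \<in> \<eta>" for \<xi> \<eta> s t
    unfolding \<delta>_def using boundary_dist_diagonal_limit[OF that] eps_pos
    by (intro tendsto_powr' tendsto_const) (auto simp: less_imp_le)
  show "boundary_dist p \<xi> \<zeta> powr \<epsilon> \<le> boundary_dist p \<xi> \<eta> powr \<epsilon> + boundary_dist p \<eta> \<zeta> powr \<epsilon>"
    by (rule tendsto_le[OF _ tendsto_add[OF pw[OF \<xi> \<eta> s t] pw[OF \<eta> \<zeta> t u]] pw[OF \<xi> \<zeta> s u]])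
      (auto simp: \<delta>_triangle)
qed

lemma boundary_dist_eq_0_iff:
  fixes \<xi> \<eta> :: "(nat \<Rightarrow> 'a) set"
  assumes \<xi>: "\<xi> \<in> gromov_boundary" and \<eta>: "\<eta> \<in> gromov_boundary"
  shows "boundary_dist p \<xi> \<eta> = 0 \<longleftrightarrow> \<xi> = \<eta>"
proof -
  obtain s t where s: "s \<in> \<xi>" and t: "t \<in> \<eta>" using gromov_boundary_nonempty \<xi> \<eta> by blast
  have conv: "converges_to_infinity s" "converges_to_infinity t"
    using s t gromov_boundary_eq_iff[OF \<xi> \<xi> s s] gromov_boundary_eq_iff[OF \<eta> \<eta> t t]
    by (auto simp: boundary_rel_def)
  have iff: "((\<lambda>(i, j). gromov_dist q (s i) (t j)) \<longlongrightarrow> 0) (sequentially \<times>\<^sub>F sequentially) \<longleftrightarrow>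
      boundary_dist q \<xi> \<eta> = 0" for q
    using boundary_dist_limit[OF \<xi> \<eta> s t, of q] tendsto_unique[OF _ boundary_dist_limit[OF \<xi> \<eta> s t], of q 0]
    by (auto simp: prod_filter_eq_bot)
  \<comment> \<open>\<open>boundary_rel\<close> speaks of all base points, the claim of one; the
    base change bound carries vanishing from \<open>p\<close> to every \<open>q\<close>.\<close>
  have "boundary_dist q \<xi> \<eta> = 0" if "boundary_dist p \<xi> \<eta> = 0" for q
    using boundary_dist_base_change[OF \<xi> \<eta>, of q p] boundary_dist_nonneg[OF \<xi> \<eta>, of q] that by simp
  then have "boundary_dist p \<xi> \<eta> = 0 \<longleftrightarrow> (s, t) \<in> boundary_rel"
    using conv iff by (auto simp: boundary_rel_def gromov_product_at_top_iff)
  then show ?thesis using gromov_boundary_eq_iff[OF \<xi> \<eta> s t] by simp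
qed

lemma boundary_dist_pos:
  fixes \<xi> \<eta> :: "(nat \<Rightarrow> 'a) set"
  shows "\<lbrakk>\<xi> \<in> gromov_boundary; \<eta> \<in> gromov_boundary; \<xi> \<noteq> \<eta>\<rbrakk> \<Longrightarrow> boundary_dist p \<xi> \<eta> > 0"
  using boundary_dist_nonneg[of \<xi> \<eta> p] boundary_dist_eq_0_iff[of \<xi> \<eta> p] by linarith

end

section \<open>The cross-ratio of the boundary\<close>

lemma ennreal_quotient:
  assumes "n \<ge> 0" "d \<ge> 0" "n \<noteq> 0 \<or> d \<noteq> 0"
  shows ennreal_quotient_eq_0: "ennreal n / ennreal d = 0 \<longleftrightarrow> n = 0"
    and ennreal_quotient_eq_top: "ennreal n / ennreal d = \<infinity> \<longleftrightarrow> d = 0"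
  using assms by (cases "d = 0"; auto simp: divide_ennreal)+

text \<open>The correction splits into a factor for \<open>x\<close> and a factor for
  \<open>y\<close>. In a cross-ratio each such factor occurs once above and once below and cancels,
  whereas \<open>gromov_dist_base_change\<close> gives only comparability up to a constant.\<close>

lemma gromov_dist_base_change_eq:
  "gromov_dist q x y = exp ((dist p x - dist q x) / 2) * exp ((dist p y - dist q y) / 2) * gromov_dist p x y"
proof -
  have "- gromov_product q x y = (dist p x - dist q x) / 2 + (dist p y - dist q y) / 2 + - gromov_product p x y"
    by (simp add: gromov_product_def field_simps)
  then show ?thesis unfolding gromov_dist_def by (simp only: exp_add)
qed

lemma inj_boundary_act: "g \<in> carrier isometry_group \<Longrightarrow> inj (boundary_act g)"
proof -
  assume "g \<in> carrier isometry_group"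
  then have "inj (\<lambda>s :: nat \<Rightarrow> _. g \<circ> s)" by (auto simp: isometry_group_def inj_def fun_eq_iff bij_def)
  from inj_image_eq_iff[OF this] show ?thesis unfolding boundary_act_def by (simp add: inj_def)
qed

context strongly_eps_hyperbolic_space
begin

lemma multiplicative_cross_ratio_cross_ratio:
  "multiplicative_cross_ratio gromov_boundary (cross_ratio (p::'a))"
  unfolding multiplicative_cross_ratio_def
proof (intro conjI allI ballI impI)
  fix x x' y y' :: "(nat \<Rightarrow> 'a) set"
  assume q: "(x, x', y, y') \<in> quadruples gromov_boundary"
  then have mem: "x \<in> gromov_boundary" "x' \<in> gromov_boundary" "y \<in> gromov_boundary" "y' \<in> gromov_boundary"
    by (auto simp: quadruples_iff)
  define n where "n = boundary_dist p x x' * boundary_dist p y y'"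
  define d where "d = boundary_dist p x y' * boundary_dist p y x'"
  have nd: "n \<ge> 0" "d \<ge> 0" "n = 0 \<longleftrightarrow> x = x' \<or> y = y'" "d = 0 \<longleftrightarrow> x = y' \<or> y = x'"
    using mem by (auto simp: n_def d_def boundary_dist_nonneg boundary_dist_eq_0_iff)
  moreover have "n \<noteq> 0 \<or> d \<noteq> 0" using nd q by (auto simp: quadruples_iff)
  ultimately show "(cross_ratio p (x, x', y, y') = 0) = (x = x' \<or> y = y')"
    "(cross_ratio p (x, x', y, y') = \<infinity>) = (x = y' \<or> y = x')"
    using ennreal_quotient[of n d] by (simp_all add: cross_ratio_def n_def d_def)
next
  fix x y z :: "(nat \<Rightarrow> 'a) set"
  assume "x \<in> gromov_boundary" "y \<in> gromov_boundary" "z \<in> gromov_boundary" "x \<noteq> y \<and> x \<noteq> z \<and> y \<noteq> z"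
  then have "boundary_dist p x z * boundary_dist p y z > 0"
    by (simp add: boundary_dist_pos)
  then show "cross_ratio p (x, z, y, z) = 1"
    by (simp add: cross_ratio_def divide_ennreal less_imp_neq[symmetric])
next
  fix x x' x'' y y' :: "(nat \<Rightarrow> 'a) set"
  assume mem: "x \<in> gromov_boundary" "x' \<in> gromov_boundary" "x'' \<in> gromov_boundary"
      "y \<in> gromov_boundary" "y' \<in> gromov_boundary"
    and ne: "y \<noteq> y' \<and> x \<notin> {y, y'} \<and> x' \<notin> {y, y'} \<and> x'' \<notin> {y, y'}"
  have pos: "boundary_dist p v w > 0" if "v \<in> {x, x', x''}" "w \<in> {y, y'}" for v w
    using that mem ne by (auto intro!: boundary_dist_pos)
  show "cross_ratio p (x, y, x', y') = cross_ratio p (x, y, x'', y') * cross_ratio p (x'', y, x', y')"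
    using pos[of x y] pos[of x y'] pos[of x' y] pos[of x' y'] pos[of x'' y] pos[of x'' y']
    by (simp add: cross_ratio_def divide_ennreal less_imp_le less_imp_neq[symmetric] flip: ennreal_mult)
qed

text \<open>The cross-ratios of representing sequences agree term by term for \<open>p\<close> and
  \<open>q\<close>, so their limits agree. Coincidences that make the denominator vanish in the
  limit are treated first, by the value infinity.\<close>

lemma cross_ratio_base_change:
  assumes q4: "(a, a', b, b') \<in> quadruples gromov_boundary"
  shows "cross_ratio (p::'a) (a, a', b, b') = cross_ratio q (a, a', b, b')"
proof (cases "a = b' \<or> b = a'")
  case True
  then have "cross_ratio r (a, a', b, b') = \<infinity>" for r :: 'a
    using multiplicative_cross_ratio_eq_top[OF multiplicative_cross_ratio_cross_ratio q4] by blast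
  then show ?thesis by simp
next
  case False
  have mem: "a \<in> gromov_boundary" "a' \<in> gromov_boundary" "b \<in> gromov_boundary" "b' \<in> gromov_boundary"
    using q4 by (auto simp: quadruples_iff)
  obtain s s' t t' where st: "s \<in> a" "s' \<in> a'" "t \<in> b" "t' \<in> b'"
    using gromov_boundary_nonempty mem by meson
  define R where "R r n = gromov_dist r (s n) (s' n) * gromov_dist r (t n) (t' n) /
    (gromov_dist r (s n) (t' n) * gromov_dist r (t n) (s' n))" for r :: 'a and n
  define L where "L r = boundary_dist r a a' * boundary_dist r b b' /
    (boundary_dist r a b' * boundary_dist r b a')" for r :: 'a
  have pos: "boundary_dist r a b' > 0" "boundary_dist r b a' > 0" for r
    using mem False by (auto intro!: boundary_dist_pos)
  have "R r \<longlonglongrightarrow> L r" for r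
    unfolding R_def[abs_def] L_def using pos[of r] mem st
    by (intro tendsto_divide tendsto_mult boundary_dist_diagonal_limit) auto
  moreover have "R p = R q"
    by (rule ext)
      (simp add: R_def gromov_dist_base_change_eq[of q _ _ p] gromov_dist_pos[THEN less_imp_neq, symmetric] field_simps)
  ultimately have "L p = L q" by (metis LIMSEQ_unique)
  moreover have "cross_ratio r (a, a', b, b') = ennreal (L r)" for r
    using pos[of r] mem by (simp add: cross_ratio_def L_def divide_ennreal boundary_dist_nonneg)
  ultimately show ?thesis by simp
qed

text \<open>\<open>boundary_topology\<close> quantifies over all base points, so a ball for
  \<open>p\<close> must contain, around each of its points, a ball for every other base point
  \<open>q\<close>.\<close>

lemma openin_boundary_ball:
  assumes x: "x \<in> gromov_boundary"
  shows "openin boundary_topology {w \<in> gromov_boundary. boundary_dist (p::'a) x w < r}" (is "openin _ ?U")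
  unfolding openin_boundary_topology
proof (intro conjI allI ballI)
  fix q and y assume "y \<in> ?U"
  then have y: "y \<in> gromov_boundary" "boundary_dist p x y < r" by auto
  have r: "r > 0" using boundary_dist_nonneg[OF x y(1), of p] y(2) by linarith
  \<comment> \<open>The slack left at \<open>y\<close>, measured in the power \<epsilon>, where the
    triangle inequality holds. Undoing the power and dividing by \<open>exp (dist q p)\<close> turns
    it into a radius for \<open>q\<close>.\<close>
  define u where "u = r powr \<epsilon> - boundary_dist p x y powr \<epsilon>"
  have u: "u > 0" using powr_less_mono2[OF eps_pos _ y(2)] boundary_dist_nonneg[OF x y(1)] by (simp add: u_def)
  have "z \<in> ?U" if z: "z \<in> gromov_boundary" and d: "boundary_dist q y z < u powr (1 / \<epsilon>) / exp (dist q p)" for z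
  proof -
    have "boundary_dist p y z \<le> exp (dist q p) * boundary_dist q y z"
      by (rule boundary_dist_base_change[OF y(1) z])
    also have "\<dots> < u powr (1 / \<epsilon>)" using d by (simp add: field_simps)
    finally have "boundary_dist p y z powr \<epsilon> < (u powr (1 / \<epsilon>)) powr \<epsilon>"
      using eps_pos boundary_dist_nonneg[OF y(1) z] by (intro powr_less_mono2) auto
    also have "\<dots> = u" using u eps_pos by (simp add: powr_powr)
    finally have "boundary_dist p x z powr \<epsilon> < r powr \<epsilon>"
      using boundary_dist_triangle[OF x y(1) z, of p] by (simp add: u_def)
    then have "boundary_dist p x z < r"
      using powr_mono2[of \<epsilon> r "boundary_dist p x z"] eps_pos r by linarith
    then show ?thesis using z by simp
  qed
  then show "\<exists>r>0. \<forall>\<eta>\<in>gromov_boundary. boundary_dist q y \<eta> < r \<longrightarrow> \<eta> \<in> ?U"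
    using u by (intro exI[of _ "u powr (1 / \<epsilon>) / exp (dist q p)"]) simp
qed auto

text \<open>For fixed \<open>x\<close>, \<open>y\<close>, \<open>z\<close> the cross-ratio at
  \<open>w\<close> is the distance from \<open>w\<close> to \<open>x\<close>, times a positive
  constant, divided by the distance from \<open>w\<close> to \<open>z\<close>. The divisor is at
  most 1 and stays away from 0 near \<open>x\<close>, so smallness of the cross-ratio and closeness
  to \<open>x\<close> control each other.\<close>

lemma generates_topology_cross_ratio: "generates_topology boundary_topology (cross_ratio (p::'a))"
  unfolding generates_topology_def topspace_boundary_topology
proof (intro ballI impI conjI allI)
  fix x y z :: "(nat \<Rightarrow> 'a) set" and e :: real
  assume mem: "x \<in> gromov_boundary" "y \<in> gromov_boundary" "z \<in> gromov_boundary"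
    and ne: "x \<noteq> y \<and> x \<noteq> z \<and> y \<noteq> z"
  let ?d = "boundary_dist p"
  define k where "k = ?d y z / ?d y x"
  have D: "?d x z > 0" and dyx: "?d y x > 0" and k: "k > 0"
    using mem ne by (auto simp: k_def intro!: divide_pos_pos boundary_dist_pos)
  \<comment> \<open>The form without division covers \<open>w = z\<close> as well: there the
    cross-ratio is infinite and the first conjunct fails.\<close>
  have cr: "cross_ratio p (w, x, y, z) < ennreal e \<longleftrightarrow> ?d w z > 0 \<and> ?d x w * k < e * ?d w z"
    if w: "w \<in> gromov_boundary" and e: "e > 0" for w and e :: real
  proof (cases "w = z")
    case True
    then have "cross_ratio p (w, x, y, z) = \<infinity>"
      using multiplicative_cross_ratio_eq_top[OF multiplicative_cross_ratio_cross_ratio, of w x y z] mem ne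
      by (simp add: quadruples_iff)
    then show ?thesis using True mem boundary_dist_eq_0_iff[of z z p] by simp
  next
    case False
    then have wz: "?d w z > 0" using w mem by (simp add: boundary_dist_pos)
    then have "cross_ratio p (w, x, y, z) = ennreal (?d x w * ?d y z / (?d w z * ?d y x))"
      using w mem dyx by (simp add: cross_ratio_def divide_ennreal boundary_dist_nonneg boundary_dist_commute[of w x])
    also have "\<dots> < ennreal e \<longleftrightarrow> ?d x w * ?d y z / (?d w z * ?d y x) < e"
      using w mem e by (intro ennreal_less_iff) (simp add: boundary_dist_nonneg)
    also have "\<dots> \<longleftrightarrow> ?d x w * k < e * ?d w z"
      using wz dyx by (simp add: k_def field_simps)
    finally show ?thesis using wz by simp
  qed
  show "\<exists>U. openin boundary_topology U \<and> x \<in> U \<and> U \<subseteq> {w \<in> gromov_boundary. cross_ratio p (w, x, y, z) < ennreal e}"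
    if e: "e > 0"
  proof -
    \<comment> \<open>Half the distance from \<open>x\<close> to \<open>z\<close> in the power
      \<epsilon>: points closer than \<open>D'\<close> to \<open>x\<close> are farther than
      \<open>D'\<close> from \<open>z\<close>. The bound \<open>e * D' / k\<close> in
      \<open>r\<close> then makes the quotient smaller than \<open>e\<close>.\<close>
    define D' where "D' = (?d x z powr \<epsilon> / 2) powr (1 / \<epsilon>)"
    have D': "D' > 0" "D' powr \<epsilon> = ?d x z powr \<epsilon> / 2" using D eps_pos by (simp_all add: D'_def powr_powr)
    define r where "r = min D' (e * D' / k)"
    let ?U = "{w \<in> gromov_boundary. ?d x w < r}"
    have "cross_ratio p (w, x, y, z) < ennreal e" if "w \<in> ?U" for w
    proof -
      have w: "w \<in> gromov_boundary" "?d x w < D'" "?d x w * k < e * D'"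
        using that k by (auto simp: r_def field_simps)
      have "?d x w powr \<epsilon> < ?d x z powr \<epsilon> / 2"
        using powr_less_mono2[OF eps_pos _ w(2)] boundary_dist_nonneg[OF mem(1) w(1)] D' by simp
      then have "D' powr \<epsilon> < ?d w z powr \<epsilon>"
        using boundary_dist_triangle[OF mem(1) w(1) mem(3), of p] D'(2) by simp
      then have "D' < ?d w z"
        using powr_mono2[of \<epsilon> "?d w z" D'] eps_pos boundary_dist_nonneg[OF w(1) mem(3), of p] by linarith
      then have "?d x w * k < e * ?d w z" "?d w z > 0"
        using w(3) mult_strict_left_mono[of D' "?d w z" e] e D'(1) by linarith+
      then show ?thesis using cr[OF w(1) e] by blast
    qed
    moreover have "x \<in> ?U" using mem D' k e boundary_dist_eq_0_iff[of x x] by (simp add: r_def)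
    ultimately show ?thesis using openin_boundary_ball[OF mem(1), of p r] by blast
  qed
  show "\<exists>e>0. {w \<in> gromov_boundary. cross_ratio p (w, x, y, z) < ennreal e} \<subseteq> U"
    if U: "openin boundary_topology U \<and> x \<in> U" for U
  proof -
    obtain r where r: "r > 0" "\<And>w. \<lbrakk>w \<in> gromov_boundary; ?d x w < r\<rbrakk> \<Longrightarrow> w \<in> U"
      using U unfolding openin_boundary_topology by blast
    have "w \<in> U" if w: "w \<in> gromov_boundary" and "cross_ratio p (w, x, y, z) < ennreal (r * k)" for w
    proof (rule r(2)[OF w])
      have "?d x w * k < r * k * ?d w z" using that(2) cr[OF w, of "r * k"] r k by simp
      also have "\<dots> \<le> r * k" using boundary_dist_le_1[OF w mem(3), of p] r k by simp
      finally show "?d x w < r" using k by simp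
    qed
    then show ?thesis using r k by (intro exI[of _ "r * k"]) auto
  qed
qed

section \<open>The action of isometries on the boundary\<close>

lemma boundary_act_mem:
  assumes g: "g \<in> carrier isometry_group" and \<xi>: "\<xi> \<in> gromov_boundary"
  shows "boundary_act g (\<xi> :: (nat \<Rightarrow> 'a) set) \<in> gromov_boundary"
proof -
  have bij: "bij g" and iso: "\<And>x y. dist (g x) (g y) = dist x y"
    using g by (auto simp: isometry_group_def)
  have gp: "gromov_product p (g x) (g y) = gromov_product (inv_into UNIV g p) x y" for p x y
    using iso[of "inv_into UNIV g p"] bij by (simp add: gromov_product_def iso bij_is_surj surj_f_inv_f)
  \<comment> \<open>Applying \<open>g\<close> to both points amounts to moving the base point by the
    inverse of \<open>g\<close>, which only permutes the base points quantified over.\<close>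
  have gp': "(\<forall>p. P (\<lambda>x y. gromov_product p (g x) (g y))) \<longleftrightarrow> (\<forall>p. P (gromov_product p))" for P
    unfolding gp using bij by (metis bij_inv_eq_iff)
  have conv: "converges_to_infinity (g \<circ> s) \<longleftrightarrow> converges_to_infinity s" for s
    unfolding converges_to_infinity_def comp_def
    using gp'[of "\<lambda>f. filterlim (\<lambda>(i, j). f (s i) (s j)) at_top (sequentially \<times>\<^sub>F sequentially)"] by simp
  have rel: "(g \<circ> s, g \<circ> t) \<in> boundary_rel \<longleftrightarrow> (s, t) \<in> boundary_rel" for s t
    unfolding boundary_rel_def mem_Collect_eq prod.case conv unfolding comp_def
    using gp'[of "\<lambda>f. filterlim (\<lambda>(i, j). f (s i) (t j)) at_top (sequentially \<times>\<^sub>F sequentially)"] by simp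
  obtain s where s: "converges_to_infinity s" "\<xi> = boundary_rel `` {s}"
    using \<xi> by (auto simp: gromov_boundary_def elim!: quotientE)
  have "boundary_act g \<xi> = boundary_rel `` {g \<circ> s}"
  proof (intro equalityI subsetI)
    fix t assume "t \<in> boundary_rel `` {g \<circ> s}"
    \<comment> \<open>Surjectivity of \<open>g\<close> is what makes the image of a class a whole
      class and not just a part of one.\<close>
    moreover have "t = g \<circ> (inv_into UNIV g \<circ> t)" using bij by (simp add: fun_eq_iff bij_is_surj surj_f_inv_f)
    ultimately show "t \<in> boundary_act g \<xi>" unfolding boundary_act_def s(2)
      using rel[of s "inv_into UNIV g \<circ> t"] by (metis Image_singleton_iff image_eqI)
  qed (auto simp: boundary_act_def s(2) rel)
  then show ?thesis using s(1) conv by (auto simp: gromov_boundary_def intro: quotientI)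
qed

text \<open>An isometry preserves boundary distances exactly when the base point moves along from
  \<open>p\<close> to \<open>g p\<close>; base change then returns to \<open>p\<close>.\<close>

lemma cross_ratio_boundary_act:
  assumes g: "g \<in> carrier isometry_group" and q4: "(a, a', b, b') \<in> quadruples gromov_boundary"
  shows "cross_ratio (p::'a) (boundary_act g a, boundary_act g a', boundary_act g b, boundary_act g b') =
    cross_ratio p (a, a', b, b')"
proof -
  have iso: "\<And>x y. dist (g x) (g y) = dist x y" using g by (auto simp: isometry_group_def)
  have "boundary_dist (g p) (boundary_act g \<xi>) (boundary_act g \<eta>) = boundary_dist p \<xi> \<eta>" for \<xi> \<eta>
    by (simp add: boundary_dist_def boundary_act_def gromov_dist_isometry[of g, OF iso])
  then have "cross_ratio (g p) (boundary_act g a, boundary_act g a', boundary_act g b, boundary_act g b') =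
      cross_ratio p (a, a', b, b')"
    by (simp add: cross_ratio_def)
  moreover have "(boundary_act g a, boundary_act g a', boundary_act g b, boundary_act g b') \<in> quadruples gromov_boundary"
    using q4 boundary_act_mem[OF g] inj_boundary_act[OF g] by (auto simp: quadruples_iff inj_eq)
  ultimately show ?thesis using cross_ratio_base_change by metis
qed

end

text \<open>For the normalisation, exchanging the second and fourth entries inverts the value but
  leaves \<open>(x, z, y, z)\<close> unchanged; a positive finite number equal to its own inverse is
  1.\<close>

lemma multiplicative_cross_ratio_abstract:
  assumes "abstract_cross_ratio T B"
  shows "multiplicative_cross_ratio (topspace T) B"
proof -
  let ?Q = "quadruples (topspace T)"
  note symm = assms[unfolded abstract_cross_ratio_def, THEN conjunct2, THEN conjunct1, rule_format]
    and cocycle = assms[unfolded abstract_cross_ratio_def, THEN conjunct2, THEN conjunct2, rule_format]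
  have B0: "B (x, x', y, y') = 0 \<longleftrightarrow> x = x' \<or> y = y'"
    and Btop: "B (x, x', y, y') = \<infinity> \<longleftrightarrow> x = y' \<or> y = x'"
    and Binv: "B (x, x', y, y') = inverse (B (x, y', y, x'))"
    if "(x, x', y, y') \<in> ?Q" for x x' y y'
    using symm[OF that] by - (elim conjE, assumption)+
  have coc: "B (x, y, x', y') = B (x, y, x'', y') * B (x'', y, x', y')"
    if "(x, y, x', y') \<in> ?Q" "(x, y, x'', y') \<in> ?Q" "(x'', y, x', y') \<in> ?Q"
      "\<not> (B (x, y, x'', y') = 0 \<and> B (x'', y, x', y') = \<infinity>)"
      "\<not> (B (x, y, x'', y') = \<infinity> \<and> B (x'', y, x', y') = 0)" for x y x' y' x''
    by (rule cocycle) (use that in \<open>intro conjI\<close>)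
  have one: "B (x, z, y, z) = 1"
    if "x \<in> topspace T" "y \<in> topspace T" "z \<in> topspace T" "x \<noteq> y \<and> x \<noteq> z \<and> y \<noteq> z" for x y z
  proof -
    have q: "(x, z, y, z) \<in> ?Q" using that by (simp add: quadruples_iff)
    obtain r where r: "B (x, z, y, z) = ennreal r" "r > 0"
      using B0[OF q] Btop[OF q] that by (cases "B (x, z, y, z)") (auto simp: less_le)
    then have "r = inverse r" using Binv[OF q] by (simp add: inverse_ennreal)
    then have "r * r = 1" using r(2) by (metis less_irrefl right_inverse)
    then have "r = 1" using r(2) by (simp add: square_eq_1_iff)
    then show ?thesis using r by simp
  qed
  have cocycle': "B (x, y, x', y') = B (x, y, x'', y') * B (x'', y, x', y')"
    if "x \<in> topspace T" "x' \<in> topspace T" "x'' \<in> topspace T" "y \<in> topspace T" "y' \<in> topspace T"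
      "y \<noteq> y' \<and> x \<notin> {y, y'} \<and> x' \<notin> {y, y'} \<and> x'' \<notin> {y, y'}" for x x' x'' y y'
  proof -
    have q: "(x, y, x', y') \<in> ?Q" "(x, y, x'', y') \<in> ?Q" "(x'', y, x', y') \<in> ?Q"
      using that by (auto simp: quadruples_iff)
    show ?thesis using coc[OF q] Btop[OF q(2)] Btop[OF q(3)] that by auto
  qed
  show ?thesis unfolding multiplicative_cross_ratio_def
    by (intro conjI allI ballI impI) (rule B0 Btop one cocycle'; assumption)+
qed

section \<open>Pullback of cross-ratios along embeddings\<close>

lemma quadruples_map:
  assumes f: "inj_on f Y" "f ` Y \<subseteq> Z" and q: "(w, x, y, z) \<in> quadruples Y"
  shows "(f w, f x, f y, f z) \<in> quadruples Z"
proof -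
  have Y: "w \<in> Y" "x \<in> Y" "y \<in> Y" "z \<in> Y" using q by (simp_all add: quadruples_iff)
  then have "f w \<in> Z" "f x \<in> Z" "f y \<in> Z" "f z \<in> Z" using f(2) by auto
  then show ?thesis using q Y by (simp add: quadruples_iff inj_on_eq_iff[OF f(1)])
qed

lemma multiplicative_cross_ratio_pullback:
  assumes C: "multiplicative_cross_ratio Z C" and f: "inj_on f Y" "f ` Y \<subseteq> Z"
  shows "multiplicative_cross_ratio Y (\<lambda>(w, x, y, z). C (f w, f x, f y, f z))"
proof -
  have eq: "f v = f w \<longleftrightarrow> v = w" if "v \<in> Y" "w \<in> Y" for v w
    using f(1) that by (simp add: inj_on_eq_iff)
  have mem: "f v \<in> Z" if "v \<in> Y" for v using f(2) that by auto
  show ?thesis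
    unfolding multiplicative_cross_ratio_def prod.case
  proof (intro conjI allI ballI impI)
    fix x x' y y' assume q: "(x, x', y, y') \<in> quadruples Y"
    then have "x \<in> Y" "x' \<in> Y" "y \<in> Y" "y' \<in> Y" by (auto simp: quadruples_iff)
    then show "(C (f x, f x', f y, f y') = 0) = (x = x' \<or> y = y')"
      "(C (f x, f x', f y, f y') = \<infinity>) = (x = y' \<or> y = x')"
      using multiplicative_cross_ratio_eq_0[OF C quadruples_map[OF f q]]
        multiplicative_cross_ratio_eq_top[OF C quadruples_map[OF f q]] by (simp_all add: eq)
  qed (auto simp: eq mem intro: multiplicative_cross_ratio_eq_1[OF C] multiplicative_cross_ratio_cocycle[OF C])
qed

lemma embedding_map_inj_on: "embedding_map S T f \<Longrightarrow> inj_on f (topspace S)"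
  by (simp add: embedding_map_def homeomorphic_imp_injective_map)

lemma embedding_map_imp_continuous: "embedding_map S T f \<Longrightarrow> continuous_map S T f"
  unfolding embedding_map_def using homeomorphic_imp_continuous_map continuous_map_into_fulltopology by blast

lemma embedding_map_image_subset: "embedding_map S T f \<Longrightarrow> f ` topspace S \<subseteq> topspace T"
  by (simp add: embedding_map_imp_continuous continuous_map_image_subset_topspace)

text \<open>Continuity pulls neighbourhoods of \<open>f x\<close> back to \<open>x\<close>.
  Conversely, the image of an open \<open>U\<close> is the trace on the image of \<open>f\<close> of
  an open \<open>V\<close>; a small cross-ratio puts \<open>f w\<close> in \<open>V\<close>, and
  injectivity brings \<open>w\<close> back into \<open>U\<close>.\<close>

lemma generates_topology_pullback:
  assumes f: "embedding_map S T f" and gen: "generates_topology T C"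
  shows "generates_topology S (\<lambda>(w, x, y, z). C (f w, f x, f y, f z))"
  unfolding generates_topology_def prod.case
proof (intro ballI impI)
  fix x y z assume mem: "x \<in> topspace S" "y \<in> topspace S" "z \<in> topspace S" and ne: "x \<noteq> y \<and> x \<noteq> z \<and> y \<noteq> z"
  have inj: "inj_on f (topspace S)" and cont: "continuous_map S T f"
    by (rule embedding_map_inj_on[OF f] embedding_map_imp_continuous[OF f])+
  have opn: "open_map S (subtopology T (f ` topspace S)) f" 
    using f homeomorphic_imp_open_map by (auto simp: embedding_map_def)
  have fx: "{f x, f y, f z} \<subseteq> topspace T" "distinct [f x, f y, f z]"
    using mem ne cont inj by (auto simp: inj_on_eq_iff continuous_map_def)
  show "(\<forall>\<epsilon>>0. \<exists>U. openin S U \<and> x \<in> U \<and> U \<subseteq> {w \<in> topspace S. C (f w, f x, f y, f z) < ennreal \<epsilon>}) \<and>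
    (\<forall>U. openin S U \<and> x \<in> U \<longrightarrow>
      (\<exists>\<epsilon>>0. {w \<in> topspace S. C (f w, f x, f y, f z) < ennreal \<epsilon>} \<subseteq> U))"
  proof (intro conjI allI impI)
    fix \<epsilon> :: real assume "\<epsilon> > 0"
    then obtain V where V: "openin T V" "f x \<in> V" "V \<subseteq> {w \<in> topspace T. C (w, f x, f y, f z) < ennreal \<epsilon>}"
      using generates_topologyD(1)[OF gen fx] by blast
    show "\<exists>U. openin S U \<and> x \<in> U \<and> U \<subseteq> {w \<in> topspace S. C (f w, f x, f y, f z) < ennreal \<epsilon>}"
      using openin_continuous_map_preimage[OF cont V(1)] V(2,3) mem(1)
      by (intro exI[of _ "{w \<in> topspace S. f w \<in> V}"]) auto
  next
    fix U assume U: "openin S U \<and> x \<in> U"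
    then obtain V where V: "openin T V" "f ` U = V \<inter> f ` topspace S"
      using opn unfolding open_map_def openin_subtopology by metis
    then have "f x \<in> V" using U by blast
    then obtain \<epsilon> where \<epsilon>: "\<epsilon> > 0" "{w \<in> topspace T. C (w, f x, f y, f z) < ennreal \<epsilon>} \<subseteq> V"
      using generates_topologyD(2)[OF gen fx V(1)] by auto
    have "w \<in> U" if w: "w \<in> topspace S" "C (f w, f x, f y, f z) < ennreal \<epsilon>" for w
    proof -
      have "f w \<in> f ` U" using V(2) \<epsilon>(2) w cont by (auto simp: continuous_map_def)
      then show ?thesis using inj w(1) openin_subset[of S U] U by (simp add: inj_on_image_mem_iff)
    qed
    then show "\<exists>\<epsilon>>0. {w \<in> topspace S. C (f w, f x, f y, f z) < ennreal \<epsilon>} \<subseteq> U" using \<epsilon>(1) by blast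
  qed
qed

lemma strongly_hyperbolic_locale:
  "strongly_hyperbolic TYPE('a::metric_space) \<Longrightarrow> \<exists>\<epsilon>. strongly_eps_hyperbolic_space TYPE('a) \<epsilon>"
  by (auto simp: strongly_hyperbolic_def strongly_eps_hyperbolic_space_def)

theorem proposition8:
  fixes \<Gamma> :: "('a::metric_space \<Rightarrow> 'a) set"
  assumes "strongly_hyperbolic TYPE('a)"
    and "subgroup \<Gamma> isometry_group"
    and "three_transitive_on_boundary \<Gamma>"
  shows "(\<forall>B. abstract_cross_ratio boundary_topology B \<and>
            generates_topology boundary_topology B \<and>
            boundary_invariant \<Gamma> B \<longrightarrow>
            (\<exists>t>0. \<forall>p. \<forall>(w, x, y, z)\<in>quadruples gromov_boundary.
               B (w, x, y, z) = ennreal_powr (cross_ratio p (w, x, y, z)) t)) \<and>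
         (\<forall>(f :: (nat \<Rightarrow> 'a) set \<Rightarrow> (nat \<Rightarrow> 'b::metric_space) set) (\<rho> :: ('a \<Rightarrow> 'a) \<Rightarrow> ('b \<Rightarrow> 'b)).
            strongly_hyperbolic TYPE('b) \<and>
            embedding_map boundary_topology boundary_topology f \<and>
            \<rho> \<in> hom (isometry_group\<lparr>carrier := \<Gamma>\<rparr>) isometry_group \<and>
            (\<forall>g\<in>\<Gamma>. \<forall>\<xi>\<in>gromov_boundary. f (boundary_act g \<xi>) = boundary_act (\<rho> g) (f \<xi>)) \<longrightarrow>
            (\<exists>t>0. \<forall>p q. \<forall>(w, x, y, z)\<in>quadruples gromov_boundary.
               cross_ratio q (f w, f x, f y, f z) = ennreal_powr (cross_ratio p (w, x, y, z)) t))"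
proof -
  obtain \<epsilon> where "strongly_eps_hyperbolic_space TYPE('a) \<epsilon>"
    using strongly_hyperbolic_locale[OF assms(1)] by blast
  then interpret X: strongly_eps_hyperbolic_space "TYPE('a)" \<epsilon> .
  have iso: "g \<in> carrier isometry_group" if "g \<in> \<Gamma>" for g
    using subgroup.subset[OF assms(2)] that by blast
  have main: "\<exists>t>0. \<forall>p. \<forall>(w, x, y, z)\<in>quadruples gromov_boundary.
      B (w, x, y, z) = ennreal_powr (cross_ratio (p::'a) (w, x, y, z)) t"
    if B: "multiplicative_cross_ratio gromov_boundary B" "generates_topology boundary_topology B"
      and inv: "\<And>g w x y z. \<lbrakk>g \<in> \<Gamma>; (w, x, y, z) \<in> quadruples gromov_boundary\<rbrakk> \<Longrightarrow>
        B (boundary_act g w, boundary_act g x, boundary_act g y, boundary_act g z) = B (w, x, y, z)"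
    for B
  proof -
    \<comment> \<open>The exponent has to be chosen before the base point, so it is found for one
      arbitrary \<open>p0\<close> and base change extends the equation to all
      \<open>p\<close>.\<close>
    obtain p0 :: 'a where True by simp
    have "\<exists>t>0. \<forall>(w, x, y, z)\<in>quadruples (topspace boundary_topology).
        B (w, x, y, z) = ennreal_powr (cross_ratio p0 (w, x, y, z)) t"
    proof (rule invariant_cross_ratio_power[where G = "boundary_act ` \<Gamma>"])
      show "g ` topspace boundary_topology \<subseteq> topspace boundary_topology" if "g \<in> boundary_act ` \<Gamma>" for g
        using that X.boundary_act_mem iso by auto
      show "inj_on g (topspace boundary_topology)" if "g \<in> boundary_act ` \<Gamma>" for g
        using that inj_on_subset[OF inj_boundary_act[OF iso] subset_UNIV] by blast
      show "\<exists>g\<in>boundary_act ` \<Gamma>. g x = x' \<and> g y = y' \<and> g z = z'"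
        if "{x, y, z, x', y', z'} \<subseteq> topspace boundary_topology" "distinct [x, y, z]" "distinct [x', y', z']"
        for x y z x' y' z'
        using assms(3)[unfolded three_transitive_on_boundary_def, rule_format, of x y z x' y' z'] that
        by simp
      show "B (g w, g x, g y, g z) = B (w, x, y, z)"
        and "cross_ratio p0 (g w, g x, g y, g z) = cross_ratio p0 (w, x, y, z)"
        if g: "g \<in> boundary_act ` \<Gamma>" and q4: "(w, x, y, z) \<in> quadruples (topspace boundary_topology)"
        for g w x y z
      proof -
        obtain h where h: "h \<in> \<Gamma>" "g = boundary_act h" using g by blast
        show "B (g w, g x, g y, g z) = B (w, x, y, z)"
          using inv[OF h(1), of w x y z] q4 h(2) by simp
        show "cross_ratio p0 (g w, g x, g y, g z) = cross_ratio p0 (w, x, y, z)"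
          using X.cross_ratio_boundary_act[OF iso[OF h(1)], of w x y z] q4 h(2) by simp
      qed
    qed (simp_all add: B X.multiplicative_cross_ratio_cross_ratio X.generates_topology_cross_ratio)
    then obtain t where t: "t > 0" "\<And>w x y z. (w, x, y, z) \<in> quadruples gromov_boundary \<Longrightarrow>
        B (w, x, y, z) = ennreal_powr (cross_ratio p0 (w, x, y, z)) t"
      by auto
    have "B (w, x, y, z) = ennreal_powr (cross_ratio p (w, x, y, z)) t"
      if "(w, x, y, z) \<in> quadruples gromov_boundary" for p w x y z
      using t(2)[OF that] X.cross_ratio_base_change[OF that, of p p0] by simp
    then show ?thesis using t(1) by blast
  qed
  show ?thesis
  proof (intro conjI allI impI)
    fix B assume "abstract_cross_ratio boundary_topology B \<and> generates_topology boundary_topology B \<and>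
      boundary_invariant \<Gamma> B"
    then show "\<exists>t>0. \<forall>p. \<forall>(w, x, y, z)\<in>quadruples gromov_boundary.
        B (w, x, y, z) = ennreal_powr (cross_ratio (p::'a) (w, x, y, z)) t"
      using multiplicative_cross_ratio_abstract[of boundary_topology B]
      by (intro main) (auto simp: boundary_invariant_def)
  next
    fix f :: "(nat \<Rightarrow> 'a) set \<Rightarrow> (nat \<Rightarrow> 'b) set" and \<rho> :: "('a \<Rightarrow> 'a) \<Rightarrow> ('b \<Rightarrow> 'b)"
    assume asm: "strongly_hyperbolic TYPE('b) \<and> embedding_map boundary_topology boundary_topology f \<and>
      \<rho> \<in> hom (isometry_group\<lparr>carrier := \<Gamma>\<rparr>) isometry_group \<and>
      (\<forall>g\<in>\<Gamma>. \<forall>\<xi>\<in>gromov_boundary. f (boundary_act g \<xi>) = boundary_act (\<rho> g) (f \<xi>))"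
    then obtain \<epsilon>' where "strongly_eps_hyperbolic_space TYPE('b) \<epsilon>'"
      using strongly_hyperbolic_locale by blast
    then interpret X': strongly_eps_hyperbolic_space "TYPE('b)" \<epsilon>' .
    obtain q0 :: 'b where True by simp
    have emb: "embedding_map boundary_topology boundary_topology f" using asm by blast
    have f: "inj_on f gromov_boundary" "f ` gromov_boundary \<subseteq> gromov_boundary"
      using embedding_map_inj_on[OF emb] embedding_map_image_subset[OF emb] by simp_all
    have \<rho>: "\<rho> g \<in> carrier isometry_group" if "g \<in> \<Gamma>" for g
      using asm that by (auto simp: hom_def)
    have "\<exists>t>0. \<forall>p. \<forall>(w, x, y, z)\<in>quadruples gromov_boundary.
        (\<lambda>(w, x, y, z). cross_ratio q0 (f w, f x, f y, f z)) (w, x, y, z) =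
          ennreal_powr (cross_ratio (p::'a) (w, x, y, z)) t"
    proof (rule main)
      fix g w x y z assume g: "g \<in> \<Gamma>" and q4: "(w, x, y, z) \<in> quadruples (gromov_boundary :: (nat \<Rightarrow> 'a) set set)"
      \<comment> \<open>Equivariance turns invariance of the pullback under \<open>g\<close> into
        invariance of the second boundary's cross-ratio under the isometry
        \<open>\<rho> g\<close>.\<close>
      have "f (boundary_act g \<xi>) = boundary_act (\<rho> g) (f \<xi>)" if "\<xi> \<in> {w, x, y, z}" for \<xi>
        using asm g that q4 by (auto simp: quadruples_iff)
      then show "(\<lambda>(w, x, y, z). cross_ratio q0 (f w, f x, f y, f z))
          (boundary_act g w, boundary_act g x, boundary_act g y, boundary_act g z) =
        (\<lambda>(w, x, y, z). cross_ratio q0 (f w, f x, f y, f z)) (w, x, y, z)"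
        using X'.cross_ratio_boundary_act[OF \<rho>[OF g] quadruples_map[OF f q4]] by simp
    qed (fact multiplicative_cross_ratio_pullback[OF X'.multiplicative_cross_ratio_cross_ratio f]
        generates_topology_pullback[OF emb X'.generates_topology_cross_ratio])+
    then obtain t where t: "t > 0" "\<forall>p. \<forall>(w, x, y, z)\<in>quadruples gromov_boundary.
        (\<lambda>(w, x, y, z). cross_ratio q0 (f w, f x, f y, f z)) (w, x, y, z) =
          ennreal_powr (cross_ratio (p::'a) (w, x, y, z)) t"
      by blast
    have "cross_ratio q (f w, f x, f y, f z) = ennreal_powr (cross_ratio p (w, x, y, z)) t"
      if "(w, x, y, z) \<in> quadruples gromov_boundary" for p q w x y z
      using bspec[OF spec[OF t(2), of p] that] X'.cross_ratio_base_change[OF quadruples_map[OF f that], of q q0] by simp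
    then show "\<exists>t>0. \<forall>p q. \<forall>(w, x, y, z)\<in>quadruples gromov_boundary.
        cross_ratio q (f w, f x, f y, f z) = ennreal_powr (cross_ratio p (w, x, y, z)) t"
      using t(1) by blast
  qed
qed

end
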